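(* Let $H$ be a graph with $|E(H)|\ge 3$ and let $k,t$ be integers with $k=\binom{t}{2}\ge \max\{|V(H)|+2,10\}$. Then $$\operatorname{GM}_{k-1}(P_5:H)=\begin{cases}60\binom{t}{5}-12(t-4), & 5\le t\le 6;\\ 60\binom{t}{5}-3(t-3)(t-4), & t\ge 7.\end{cases}$$
   Context: All graphs are finite, simple and without isolated vertices. $P_n$ is the path on $n$ vertices. A $k$-edge-coloring of a graph is a map from its edge set onto $\{1,\dots,k\}$ that is exact, i.e. every one of the $k$ colors is used at least once. An edge-colored graph is rainbow if all its edges have distinct colors and monochromatic if all its edges have the same color. A copy of a graph $F$ in a graph $G$ is a subgraph of $G$ isomorphic to $F$; distinct copies are distinct subgraphs. For non-empty graphs $G,H$ and a positive integer $k$, the Gallai-Ramsey number $\operatorname{gr}_k(G:H)$ is the minimum integer $N$ such that for all $n\ge N$, every (exact) $k$-edge-coloring of $K_n$ contains a rainbow copy of $G$ or a monochromatic copy of $H$. The Gallai-Ramsey multiplicity $\operatorname{GM}_k(G:H)$ is the minimum, over all (exact) $k$-edge-colorings of $K_{\operatorname{gr}_k(G:H)}$, of the total number of rainbow copies of $G$ plus monochromatic copies of $H$.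
   Formalization: The Gallai-Ramsey number is the least N that also has at least k edges in K_N (so exact k-edge-colorings exist); read literally, small N qualify vacuously here and the multiplicity would be a minimum over an empty set. *)

theory Defs imports Complex_Main begin

text \<open>A graph is a pair of a vertex set and a set of edges, an edge being a two-element set.\<close>

type_synonym 'a graph = "'a set \<times> 'a set set"

abbreviation verts :: "'a graph \<Rightarrow> 'a set" where "verts \<equiv> fst"

abbreviation edges :: "'a graph \<Rightarrow> 'a set set" where "edges \<equiv> snd"

definition simple_graph :: "'a graph \<Rightarrow> bool" where
  "simple_graph G \<longleftrightarrow> finite (verts G) \<and> (\<forall>e\<in>edges G. e \<subseteq> verts G \<and> card e = 2)"

definition no_isolated_vertices :: "'a graph \<Rightarrow> bool" where
  "no_isolated_vertices G \<longleftrightarrow> (\<forall>v\<in>verts G. \<exists>e\<in>edges G. v \<in> e)"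

definition complete_graph :: "nat \<Rightarrow> nat graph" where
  "complete_graph n = ({..<n}, {e. e \<subseteq> {..<n} \<and> card e = 2})"

definition path_graph :: "nat \<Rightarrow> nat graph" where
  "path_graph n = ({..<n}, {{i, Suc i} | i. Suc i < n})"

definition subgraph :: "'a graph \<Rightarrow> 'a graph \<Rightarrow> bool" where
  "subgraph S G \<longleftrightarrow> simple_graph S \<and> verts S \<subseteq> verts G \<and> edges S \<subseteq> edges G"

definition isomorphic :: "'a graph \<Rightarrow> 'b graph \<Rightarrow> bool" where
  "isomorphic F S \<longleftrightarrow> (\<exists>f. bij_betw f (verts F) (verts S) \<and> edges S = (\<lambda>e. f ` e) ` edges F)"

definition copies :: "'a graph \<Rightarrow> 'b graph \<Rightarrow> 'b graph set" where
  "copies F G = {S. subgraph S G \<and> isomorphic F S}"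

text \<open>Exact colorings. Colorings are total functions, of which only the values on the edges of
  the graph matter.\<close>

definition edge_colorings :: "nat \<Rightarrow> 'a graph \<Rightarrow> ('a set \<Rightarrow> nat) set" where
  "edge_colorings k G = {c. c ` edges G = {1..k}}"

definition rainbow :: "('a set \<Rightarrow> nat) \<Rightarrow> 'a graph \<Rightarrow> bool" where
  "rainbow c S \<longleftrightarrow> inj_on c (edges S)"

definition monochromatic :: "('a set \<Rightarrow> nat) \<Rightarrow> 'a graph \<Rightarrow> bool" where
  "monochromatic c S \<longleftrightarrow> (\<forall>e\<in>edges S. \<forall>e'\<in>edges S. c e = c e')"

definition rainbow_copies :: "('b set \<Rightarrow> nat) \<Rightarrow> 'a graph \<Rightarrow> 'b graph \<Rightarrow> 'b graph set" where
  "rainbow_copies c F G = {S \<in> copies F G. rainbow c S}"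

definition mono_copies :: "('b set \<Rightarrow> nat) \<Rightarrow> 'a graph \<Rightarrow> 'b graph \<Rightarrow> 'b graph set" where
  "mono_copies c F G = {S \<in> copies F G. monochromatic c S}"

text \<open>The constraint \<open>k \<le> N choose 2\<close> says that \<open>K\<^sub>N\<close> has an exact \<open>k\<close>-edge-coloring. It is
  implicit in the usual definition of the Gallai-Ramsey number: without it, small \<open>N\<close> would
  qualify vacuously, and the multiplicity below would be a minimum over the empty set. For
  nonempty \<open>G\<close>, \<open>H\<close> and positive \<open>k\<close> such an \<open>N\<close> exists by Ramsey's theorem.\<close>

definition gallai_ramsey :: "nat \<Rightarrow> 'a graph \<Rightarrow> 'b graph \<Rightarrow> nat" where
  "gallai_ramsey k G H = (LEAST N. k \<le> N choose 2 \<and>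
     (\<forall>n\<ge>N. \<forall>c \<in> edge_colorings k (complete_graph n).
        rainbow_copies c G (complete_graph n) \<noteq> {} \<or> mono_copies c H (complete_graph n) \<noteq> {}))"

text \<open>An infimum of a nonempty set of natural numbers is its minimum.\<close>

definition gallai_ramsey_mult :: "nat \<Rightarrow> 'a graph \<Rightarrow> 'b graph \<Rightarrow> nat" where
  "gallai_ramsey_mult k G H =
     (let K = complete_graph (gallai_ramsey k G H) in
      INF c \<in> edge_colorings k K. card (rainbow_copies c G K) + card (mono_copies c H K))"

end

theory Submission imports Defs begin

text \<open>
  An edge coloring of a complete graph with at least nine colors and no rainbow \<open>P\<^sub>5\<close> contains a
  monochromatic clique whose size is at least the number of colors minus one. If some vertex \<open>a\<close>
  sees six colors, deleting \<open>a\<close> leaves a monochromatic graph. Otherwise take a rainbow path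
  \<open>a b c d\<close>; counting colors produces an edge with a further color that misses the path, then all
  other colors also miss it, and the two outer edges of the path together with two such edges form
  a rainbow matching all of whose cross edges have the color \<open>q\<close> of \<open>b c\<close>. Then \<open>q\<close> is
  dominant: the color classes other than \<open>q\<close> span disjoint vertex sets, and one vertex from each
  gives the clique. Hence the Gallai-Ramsey number is the least \<open>N\<close> for which \<open>K\<^sub>N\<close> has enough
  edges, namely \<open>t\<close>.

  A coloring of \<open>K\<^sub>t\<close> with one color less than there are edges repeats a color on exactly one pair of
  edges, so the copies that are not rainbow are the paths through both edges of this pair. There are
  \<open>12 (t - 4)\<close> of them if the edges are disjoint and \<open>3 (t - 3) (t - 4)\<close> if they are adjacent.
\<close>

section \<open>Colorings without a rainbow path on five vertices\<close>

text \<open>The coloring is a symmetric function of two vertices rather than of edges, so that color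
  patterns along paths become equations between terms.\<close>

locale rainbow_P5_free =
  fixes V :: "'a set" and f :: "'a \<Rightarrow> 'a \<Rightarrow> 'b"
  assumes sym: "f x y = f y x"
    and no_P5: "distinct [a, b, c, d, e] \<Longrightarrow> {a, b, c, d, e} \<subseteq> V \<Longrightarrow>
      \<not> distinct [f a b, f b c, f c d, f d e]"
begin

definition colors :: "'b set" where
  "colors = {f x y | x y. x \<in> V \<and> y \<in> V \<and> x \<noteq> y}"

lemma colorsI: "x \<in> V \<Longrightarrow> y \<in> V \<Longrightarrow> x \<noteq> y \<Longrightarrow> f x y \<in> colors"
  by (auto simp: colors_def)

abbreviation repeats :: "'a \<Rightarrow> 'a \<Rightarrow> 'a \<Rightarrow> 'a \<Rightarrow> 'a \<Rightarrow> bool" where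
  "repeats a b c d e \<equiv> f a b = f b c \<or> f a b = f c d \<or> f a b = f d e \<or>
    f b c = f c d \<or> f b c = f d e \<or> f c d = f d e"

lemma P5_repeats:
  "distinct [a, b, c, d, e] \<Longrightarrow> {a, b, c, d, e} \<subseteq> V \<Longrightarrow> repeats a b c d e"
  using no_P5[of a b c d e] by auto

section \<open>Local color patterns and vertices that see many colors\<close>

lemma monochromatic_or_adjacent_colors_differ:
  "(\<exists>q. \<forall>x\<in>S. \<forall>y\<in>S. x \<noteq> y \<longrightarrow> f x y = q) \<or>
    (\<exists>x y z. {x, y, z} \<subseteq> S \<and> distinct [x, y, z] \<and> f x y \<noteq> f y z)"
proof (rule disjCI)
  assume "\<not> (\<exists>x y z. {x, y, z} \<subseteq> S \<and> distinct [x, y, z] \<and> f x y \<noteq> f y z)"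
  then have adj: "f x y = f y z" if "x \<in> S" "y \<in> S" "z \<in> S" "x \<noteq> y" "y \<noteq> z" for x y z
    using that by (cases "x = z") (auto simp: sym)
  show "\<exists>q. \<forall>x\<in>S. \<forall>y\<in>S. x \<noteq> y \<longrightarrow> f x y = q"
  proof (cases "\<exists>x\<in>S. \<exists>y\<in>S. x \<noteq> y")
    case True
    then obtain x y where xy: "x \<in> S" "y \<in> S" "x \<noteq> y" by blast
    \<comment> \<open>Disjoint edges are joined by a third edge adjacent to both, so two uses of
      \<open>adj\<close> carry the color over.\<close>
    have "f u v = f x y" if "u \<in> S" "v \<in> S" "u \<noteq> v" for u v
      by (metis adj that xy)
    then show ?thesis by blast
  qed blast
qed

text \<open>A spare color \<open>i = f a w\<close> at \<open>a\<close> turns \<open>x y z\<close> into the five-vertex path \<open>w a x y z\<close>.\<close>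

lemma hub_edge:
  assumes six: "card (f a ` (V - {a})) \<ge> 6" and "a \<in> V"
    and "{x, y, z} \<subseteq> V - {a}" "distinct [x, y, z]" "f x y \<noteq> f y z"
  shows "f a x \<in> {f x y, f y z}"
proof -
  \<comment> \<open>The three colors at \<open>a\<close> keep \<open>w\<close> away from
    \<open>x\<close>, \<open>y\<close>, \<open>z\<close>; \<open>f a x\<close>,
    \<open>f x y\<close>, \<open>f y z\<close> are the colors that follow \<open>f w a\<close> on
    the path.\<close>
  have "card {f a x, f x y, f y z, f a y, f a z} \<le> 5"
    by (simp add: card_insert_if)
  then have "\<not> f a ` (V - {a}) \<subseteq> {f a x, f x y, f y z, f a y, f a z}"
    using six card_mono[of "{f a x, f x y, f y z, f a y, f a z}" "f a ` (V - {a})"] by auto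
  then obtain w where w: "w \<in> V" "w \<noteq> a" "f a w \<notin> {f a x, f x y, f y z, f a y, f a z}"
    by blast
  then have "w \<notin> {x, y, z}" by auto
  then show ?thesis
    using no_P5[of w a x y z] assms w by (auto simp: sym[of w a])
qed

lemma hub:
  assumes six: "card (f a ` (V - {a})) \<ge> 6" and "a \<in> V"
  shows "\<exists>q. \<forall>x\<in>V - {a}. \<forall>y\<in>V - {a}. x \<noteq> y \<longrightarrow> f x y = q"
proof (rule ccontr)
  assume "\<not> ?thesis"
  then obtain x y z where xyz: "{x, y, z} \<subseteq> V - {a}" "distinct [x, y, z]" "f x y \<noteq> f y z"
    using monochromatic_or_adjacent_colors_differ[of "V - {a}"] by blast
  have hub': "f u v = f v w \<or> (f a u = f u v \<or> f a u = f v w) \<and> (f a w = f u v \<or> f a w = f v w)"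
    if "{u, v, w} \<subseteq> V - {a}" "distinct [u, v, w]" for u v w
    using hub_edge[OF assms, of u v w] hub_edge[OF assms, of w v u] that
    by (auto simp: sym[of w v] sym[of v u])
  \<comment> \<open>\<open>a\<close> sees no color beyond \<open>f x y\<close>, \<open>f y z\<close>
    and \<open>f a y\<close>. The triples \<open>w y x\<close> and \<open>w y z\<close> force
    \<open>f w y = f a w\<close>; those on \<open>w\<close>, \<open>x\<close>, \<open>y\<close> then
    put \<open>f a y\<close> into \<open>{f a w, f x y}\<close>, and those on \<open>w\<close>,
    \<open>z\<close>, \<open>y\<close> into \<open>{f a w, f y z}\<close>.\<close>
  have key: "f a y = f a w"
    if w: "w \<in> V - {a}" "w \<noteq> y" "f a w \<noteq> f x y" "f a w \<noteq> f y z" for w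
  proof -
    have "w \<noteq> x" "w \<noteq> z" using hub'[OF xyz(1,2)] w xyz(3) by auto
    then have W: "{w, y, x} \<subseteq> V - {a}" "distinct [w, y, x]" "{w, y, z} \<subseteq> V - {a}" "distinct [w, y, z]"
       "{x, w, y} \<subseteq> V - {a}" "distinct [x, w, y]" "{w, x, y} \<subseteq> V - {a}" "distinct [w, x, y]"
       "{z, w, y} \<subseteq> V - {a}" "distinct [z, w, y]" "{w, z, y} \<subseteq> V - {a}" "distinct [w, z, y]"
      using w xyz by auto
    show ?thesis
      using hub'[OF W(1,2)] hub'[OF W(3,4)] hub'[OF W(5,6)] hub'[OF W(7,8)] hub'[OF W(9,10)]
        hub'[OF W(11,12)] hub'[OF xyz(1,2)] w(3,4) xyz(3) sym[of y w] sym[of y x] sym[of y z] sym[of x w] sym[of z w]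
      by (smt (verit))
  qed
  define F where "F = {f x y, f y z, f a y}"
  have "card F \<le> 3" by (simp add: F_def card_insert_if)
  then have "\<not> f a ` (V - {a}) \<subseteq> F"
    using six card_mono[of F "f a ` (V - {a})"] by (auto simp: F_def)
  then obtain w where "w \<in> V - {a}" "f a w \<notin> F" by blast
  then show False using key[of w] by (cases "w = y") (auto simp: F_def)
qed

text \<open>Take the triangle spanned by two adjacent edges of different colors. A color missing on
  it lies on an edge that meets it or is disjoint from it, and either way a rainbow path arises.
  Three colors would not do: a rainbow triangle has no such path.\<close>

lemma exists_rainbow_P4:
  assumes four: "card colors \<ge> 4"
  obtains a b c d where "distinct [a, b, c, d]" "{a, b, c, d} \<subseteq> V"
    "distinct [f a b, f b c, f c d]"
proof (rule ccontr)
  note outer = that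
  assume "\<not> thesis"
  then have "\<not> distinct [f a b, f b c, f c d]"
    if "distinct [a, b, c, d]" "{a, b, c, d} \<subseteq> V" for a b c d
    using that \<open>\<not> thesis\<close> outer[of a b c d] by blast
  then have no: "f a b = f b c \<or> f a b = f c d \<or> f b c = f c d"
    if "distinct [a, b, c, d]" "{a, b, c, d} \<subseteq> V" for a b c d
    using that by simp
  have "\<not> (\<exists>q. \<forall>x\<in>V. \<forall>y\<in>V. x \<noteq> y \<longrightarrow> f x y = q)"
  proof
    assume "\<exists>q. \<forall>x\<in>V. \<forall>y\<in>V. x \<noteq> y \<longrightarrow> f x y = q"
    then obtain q where "colors \<subseteq> {q}" unfolding colors_def by blast
    then have "card colors \<le> 1" using card_mono[of "{q}" colors] by auto
    then show False using four by simp
  qed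
  then obtain x y z where xyz: "{x, y, z} \<subseteq> V" "distinct [x, y, z]" "f x y \<noteq> f y z"
    using monochromatic_or_adjacent_colors_differ[of V] by blast
  define F where "F = {f x y, f y z, f x z}"
  have "card F \<le> 3" by (simp add: F_def card_insert_if)
  then have "\<not> colors \<subseteq> F"
    using four card_mono[of F colors] by (auto simp: F_def)
  then obtain u v where uv: "u \<in> V" "v \<in> V" "u \<noteq> v" "f u v \<notin> F" by (auto simp: colors_def)
  have apart: "u \<notin> {x, y, z}" if uv: "u \<in> V" "v \<in> V" "u \<noteq> v" "f u v \<notin> F" for u v
  proof
    assume u: "u \<in> {x, y, z}"
    then have v: "v \<notin> {x, y, z}" using uv by (auto simp: F_def sym)
    have ne: "f u v \<noteq> f x y" "f u v \<noteq> f y z" "f u v \<noteq> f x z" using uv by (auto simp: F_def)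
    have D: "distinct [x, y, z, v]" "{x, y, z, v} \<subseteq> V" using v xyz uv by auto
    have "f v x = f x y \<or> f v x = f y z \<or> f x y = f y z" "f v z = f z y \<or> f v z = f y x \<or> f z y = f y x"
      "f x y = f y z \<or> f x y = f z v \<or> f y z = f z v" "f x y = f y v \<or> f x y = f v z \<or> f y v = f v z"
      "f z y = f y x \<or> f z y = f x v \<or> f y x = f x v" "f z y = f y v \<or> f z y = f v x \<or> f y v = f v x"
      "f v y = f y z \<or> f v y = f z x \<or> f y z = f z x" "f v y = f y x \<or> f v y = f x z \<or> f y x = f x z"
      "f y v = f v x \<or> f y v = f x z \<or> f v x = f x z"
      by - (rule no; (insert D, auto))+
    with u show False
      using ne xyz(3) sym[of v x] sym[of v y] sym[of v z] sym[of y x] sym[of z y] sym[of z x]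
      by (smt (verit) insert_iff empty_iff)
  qed
  have n: "u \<notin> {x, y, z}" "v \<notin> {x, y, z}" using apart[of u v] apart[of v u] uv sym[of u v] by auto
  have ne: "f u v \<noteq> f x y" "f u v \<noteq> f y z" "f u v \<noteq> f x z" using uv by (auto simp: F_def)
  have D: "distinct [x, y, z, u, v]" "{x, y, z, u, v} \<subseteq> V" using n xyz uv by auto
  \<comment> \<open>The paths through \<open>z u\<close> force \<open>f z u = f y z\<close>, and
    those starting with \<open>v u y\<close> force \<open>f u y = f u v\<close>; then
    \<open>x y u z\<close> is rainbow.\<close>
  have "f x y = f y z \<or> f x y = f z u \<or> f y z = f z u" "f y z = f z u \<or> f y z = f u v \<or> f z u = f u v"
    "f v u = f u y \<or> f v u = f y x \<or> f u y = f y x" "f v u = f u y \<or> f v u = f y z \<or> f u y = f y z"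
    "f x y = f y u \<or> f x y = f u z \<or> f y u = f u z"
    by - (rule no; (insert D, auto))+
  then show False
    using ne xyz(3) sym[of z u] sym[of v u] sym[of y u] sym[of y x] by (smt (verit))
qed

end

section \<open>New colors away from a rainbow path on four vertices\<close>

locale rainbow_P4 = rainbow_P5_free +
  fixes a b c d :: 'a
  assumes P4_distinct: "distinct [a, b, c, d]" and P4_sub: "{a, b, c, d} \<subseteq> V"
    and P4_rainbow: "distinct [f a b, f b c, f c d]"
begin

text \<open>Whatever is shown for the end \<open>a\<close> and the inner vertex \<open>b\<close>
  thereby holds for \<open>d\<close> and \<open>c\<close> as well.\<close>

lemma P4_reverse: "rainbow_P4 V f d c b a"
  using P4_distinct P4_sub P4_rainbow
  by unfold_locales (auto simp: sym[of b a] sym[of c b] sym[of d c] intro: sym no_P5)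

definition outside :: "'a set" where
  "outside = V - {a, b, c, d}"

definition fresh :: "'b \<Rightarrow> bool" where
  "fresh s \<longleftrightarrow> s \<notin> {f a b, f b c, f c d}"

lemma reverse_outside: "rainbow_P4.outside V d c b a = outside"
  using rainbow_P4.outside_def[OF P4_reverse] by (auto simp: outside_def)

lemma reverse_fresh: "rainbow_P4.fresh f d c b a = fresh"
  using rainbow_P4.fresh_def[OF P4_reverse]
  by (auto simp: fresh_def fun_eq_iff sym[of d c] sym[of c b] sym[of b a])

lemma outside_distinct:
  "x \<in> outside \<Longrightarrow> distinct [a, b, c, d, x] \<and> {a, b, c, d, x} \<subseteq> V"
  using P4_distinct P4_sub by (auto simp: outside_def)

lemma end_to_outside:
  assumes "x \<in> outside"
  shows "\<not> fresh (f a x)"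
proof -
  have "repeats x a b c d"
    by (rule P5_repeats; use outside_distinct[OF assms] in auto)
  then show ?thesis using P4_rainbow by (auto simp: fresh_def sym[of x a])
qed

text \<open>On the path \<open>y x a b c\<close> only \<open>f a x\<close> can cause the repetition,
  and \<open>end_to_outside\<close> keeps it from being fresh.\<close>

lemma fresh_edge_end:
  assumes "x \<in> outside" "y \<in> outside" "x \<noteq> y" "fresh (f x y)"
  shows "f a x = f a b \<or> f a x = f b c"
proof -
  have "repeats y x a b c"
    by (rule P5_repeats; use outside_distinct[of x] outside_distinct[of y] assms in auto)
  then show ?thesis
    using assms(4) P4_rainbow end_to_outside[OF assms(1)]
    unfolding fresh_def by (smt (verit) sym distinct_length_2_or_more insertCI)
qed

lemma fresh_edge_inner:
  assumes "x \<in> outside" "y \<in> outside" "x \<noteq> y" "fresh (f x y)"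
  shows "f b x \<in> {f x y, f b c, f c d}"
proof -
  have "repeats y x b c d"
    by (rule P5_repeats; use outside_distinct[of x] outside_distinct[of y] assms in auto)
  then show ?thesis
    using assms(4) P4_rainbow
    unfolding fresh_def by (smt (verit) sym distinct_length_2_or_more insertCI)
qed

text \<open>If the colors differed, \<open>z x y a b\<close> and \<open>z x y d c\<close> would
  force \<open>f a y = f a b\<close> and \<open>f d y = f c d\<close>. Then \<open>b c d a y\<close>
  excludes fresh colors for the chord \<open>a d\<close>, while \<open>z x y a d\<close> and
  \<open>z x y d a\<close> demand the colors of both \<open>a b\<close> and \<open>c d\<close> for
  it.\<close>

lemma adjacent_fresh_edges:
  assumes "x \<in> outside" "y \<in> outside" "z \<in> outside" "x \<noteq> y" "x \<noteq> z"
    and "fresh (f x y)" "fresh (f x z)"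
  shows "f x y = f x z"
proof (cases "y = z")
  case False
  interpret rev: rainbow_P4 V f d c b a by (rule P4_reverse)
  note r = rev.fresh_edge_end[unfolded reverse_outside reverse_fresh]
  have *: "f a y = f a b \<or> f a y = f b c" "f d y = f c d \<or> f d y = f b c"
    using fresh_edge_end[of y x] r[of y x] assms sym[of y x] sym[of d c] sym[of c b] by auto
  have "repeats z x y a b" "repeats z x y d c" "repeats b c d a y" "repeats z x y a d" "repeats z x y d a"
    by - (rule P5_repeats;
      use outside_distinct[of x] outside_distinct[of y] outside_distinct[of z] assms False in auto)+
  with * show ?thesis
    using assms(6,7) P4_rainbow
    unfolding fresh_def by (smt (verit) sym distinct_length_2_or_more insertCI)
qed auto

lemma fresh_edge_end_all:
  assumes "x \<in> outside" "y \<in> outside" "x \<noteq> y" "fresh (f x y)" "v \<in> V" "v \<noteq> a" "fresh (f a v)"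
  shows "f a v = f x y"
proof -
  consider "v \<in> outside" | "v = b" | "v = c" | "v = d" using assms(5,6) by (auto simp: outside_def)
  then show ?thesis
  proof cases
    case 1 then show ?thesis using end_to_outside assms(7) by blast
  next
    case 2 then show ?thesis using assms(7) by (simp add: fresh_def)
  next
    case 3
    have "repeats x y a c d" "repeats x y a c b"
      by - (rule P5_repeats;
        use outside_distinct[of x] outside_distinct[of y] assms(1-3) in auto)+
    then show ?thesis
      using fresh_edge_end[of y x] assms(1-4,7) P4_rainbow 3 sym[of y x] sym[of c b] sym[of y a]
      unfolding fresh_def by (smt (verit) distinct_length_2_or_more insertCI)
  next
    case 4
    have "repeats x y a d c" "repeats b c d a y"
      by - (rule P5_repeats;
        use outside_distinct[of x] outside_distinct[of y] assms(1-3) in auto)+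
    then show ?thesis
      using fresh_edge_end[of y x] assms(1-4,7) P4_rainbow 4 sym[of y x] sym[of d c] sym[of y a] sym[of d a]
      unfolding fresh_def by (smt (verit) distinct_length_2_or_more insertCI)
  qed
qed

text \<open>An edge at \<open>b\<close> with a second fresh color must lead outside, to neither
  \<open>x\<close> nor \<open>y\<close>. It is excluded by letting it replace the first edge of the
  path.\<close>

lemma fresh_edge_inner_all:
  assumes "x \<in> outside" "y \<in> outside" "x \<noteq> y" "fresh (f x y)" "v \<in> V" "v \<noteq> b" "fresh (f b v)"
  shows "f b v = f x y"
proof (rule ccontr)
  assume ne: "f b v \<noteq> f x y"
  interpret rev: rainbow_P4 V f d c b a by (rule P4_reverse)
  note r = rev.fresh_edge_end_all[unfolded reverse_outside reverse_fresh]
  have "v \<noteq> a" "v \<noteq> c" "v \<noteq> d"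
    using assms(7) ne r[OF assms(1-4), of b] P4_distinct P4_sub
    by (auto simp: fresh_def sym[of b a] sym[of d b])
  moreover have "v \<noteq> x" "v \<noteq> y"
    using fresh_edge_inner[of x y] fresh_edge_inner[of y x] assms ne
    by (auto simp: fresh_def sym[of y x])
  ultimately have D: "distinct [a, b, c, d, x, y, v]" "{a, b, c, d, x, y, v} \<subseteq> V"
    using outside_distinct[of x] outside_distinct[of y] assms by auto
  have "repeats x y a b v" "repeats y x a b v"
    by - (rule P5_repeats; use D in auto)+
  then have ax: "f a x = f a b" "f a y = f a b"
    using fresh_edge_end[of x y] fresh_edge_end[of y x] assms ne P4_rainbow
    unfolding fresh_def by (smt (verit) sym distinct_length_2_or_more insertCI)+
  \<comment> \<open>For the path \<open>v b c d\<close> the vertex \<open>a\<close> is outside and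
    \<open>f a b\<close> is fresh. So \<open>x y\<close> and \<open>x a\<close> are adjacent fresh
    edges and must agree, although \<open>f x y\<close> is not \<open>f a b\<close>.\<close>
  interpret other: rainbow_P4 V f v b c d
    using D assms(7) P4_rainbow by unfold_locales (auto simp: fresh_def sym[of v b])
  have "f x y = f x a"
  proof (rule other.adjacent_fresh_edges)
    show "other.fresh (f x y)"
      using assms(4) ne by (auto simp: fresh_def other.fresh_def sym[of v b])
    show "other.fresh (f x a)"
      using assms(7) ax P4_rainbow by (auto simp: fresh_def other.fresh_def sym[of v b] sym[of x a])
  qed (use D in \<open>auto simp: other.outside_def\<close>)
  then show False using ax assms(4) by (auto simp: fresh_def sym[of x a])
qed

text \<open>Once \<open>x y\<close> is fresh, the previous lemmas and their reversals leave no other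
  fresh color at any vertex of the path.\<close>

lemma fresh_edges_outside:
  assumes "x \<in> outside" "y \<in> outside" "x \<noteq> y" "fresh (f x y)"
    and "u \<in> V" "v \<in> V" "u \<noteq> v" "fresh (f u v)" "f u v \<noteq> f x y"
  shows "u \<in> outside"
proof -
  interpret rev: rainbow_P4 V f d c b a by (rule P4_reverse)
  note r = rev.fresh_edge_end_all[unfolded reverse_outside reverse_fresh]
    rev.fresh_edge_inner_all[unfolded reverse_outside reverse_fresh]
  show ?thesis
    using fresh_edge_end_all[OF assms(1-4), of v] fresh_edge_inner_all[OF assms(1-4), of v]
      r(1)[OF assms(1-4), of v] r(2)[OF assms(1-4), of v] assms(5-)
    by (auto simp: outside_def)
qed

text \<open>The color of \<open>x z\<close> is not fresh, since it would have to equal both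
  \<open>f x y\<close> and \<open>f z w\<close>. The paths \<open>w z x y a\<close> and
  \<open>w z x y d\<close> then identify it with \<open>f a y\<close> and \<open>f d y\<close>,
  whose candidates have only \<open>f b c\<close> in common.\<close>

lemma two_fresh_edges_cross:
  assumes "distinct [x, y, z, w]" "{x, y, z, w} \<subseteq> outside"
    and "fresh (f x y)" "fresh (f z w)" "f x y \<noteq> f z w"
  shows "f x z = f b c \<and> f a y = f b c \<and> f d y = f b c"
proof -
  interpret rev: rainbow_P4 V f d c b a by (rule P4_reverse)
  note r = rev.fresh_edge_end[unfolded reverse_outside reverse_fresh]
  have D: "distinct [a, b, c, d, x, y, z, w]" "{a, b, c, d, x, y, z, w} \<subseteq> V"
    using assms outside_distinct[of x] outside_distinct[of y] outside_distinct[of z]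
      outside_distinct[of w] by auto
  have "f a y = f a b \<or> f a y = f b c" "f d y = f c d \<or> f d y = f b c"
    using fresh_edge_end[of y x] r[of y x] assms sym[of y x] sym[of d c] sym[of c b] by auto
  moreover have "\<not> fresh (f x z)"
    using adjacent_fresh_edges[of x y z] adjacent_fresh_edges[of z w x] assms sym[of z x] by auto
  moreover have "repeats w z x y a" "repeats w z x y d"
    by - (rule P5_repeats; use D in auto)+
  ultimately show ?thesis
    using assms(3-5) P4_rainbow
    unfolding fresh_def by (smt (verit) sym distinct_length_2_or_more insertCI)
qed

lemma two_fresh_edges_inner:
  assumes "distinct [x, y, z, w]" "{x, y, z, w} \<subseteq> outside"
    and "fresh (f x y)" "fresh (f z w)" "f x y \<noteq> f z w"
  shows "f b x = f b c"
proof -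
  have D: "distinct [a, b, c, d, x, y, z, w]" "{a, b, c, d, x, y, z, w} \<subseteq> V"
    using assms outside_distinct[of x] outside_distinct[of y] outside_distinct[of z]
      outside_distinct[of w] by auto
  have "f x z = f b c" using two_fresh_edges_cross[OF assms] by auto
  moreover have "f b x \<in> {f x y, f b c, f c d}"
    using fresh_edge_inner[of x y] assms by auto
  moreover have "repeats w z x b a"
    by (rule P5_repeats; use D in auto)
  ultimately show ?thesis
    using assms(3-5) P4_rainbow
    unfolding fresh_def by (smt (verit) sym distinct_length_2_or_more insert_iff empty_iff)
qed

text \<open>Entering a chord from \<open>x y\<close> leaves three candidates for its color:
  \<open>f x y\<close>, \<open>f b c\<close> and the color of the path edge traversed next. Entering
  from \<open>z w\<close> removes the first, and traversing the chord the other way removes the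
  last.\<close>

lemma two_fresh_edges_chords:
  assumes "distinct [x, y, z, w]" "{x, y, z, w} \<subseteq> outside"
    and "fresh (f x y)" "fresh (f z w)" "f x y \<noteq> f z w"
  shows "f a c = f b c \<and> f a d = f b c"
proof -
  interpret rev: rainbow_P4 V f d c b a by (rule P4_reverse)
  note r = rev.two_fresh_edges_inner[unfolded reverse_outside reverse_fresh]
  have D: "distinct [a, b, c, d, x, y, z, w]" "{a, b, c, d, x, y, z, w} \<subseteq> V"
    using assms outside_distinct[of x] outside_distinct[of y] outside_distinct[of z]
      outside_distinct[of w] by auto
  have "f a x = f b c" "f d x = f b c" "f a z = f b c"
    using two_fresh_edges_cross[of y x z w]
      two_fresh_edges_cross[of w z x y] assms sym[of y x] sym[of w z] by auto
  moreover have "f c x = f b c" using r[OF assms] sym[of c b] by simp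
  moreover have "repeats y x a c d" "repeats w z a c d" "repeats y x c a b"
    "repeats y x a d c" "repeats y x d a b" "repeats w z a d c"
    by - (rule P5_repeats; use D in auto)+
  ultimately show ?thesis
    using assms(3-5) P4_rainbow
    unfolding fresh_def by (smt (verit) sym distinct_length_2_or_more insert_iff empty_iff)
qed

end

section \<open>A dominant color and the clique it gives\<close>

context rainbow_P5_free
begin

text \<open>The fixed-point free involution \<open>\<mu>\<close> encodes a matching on \<open>U\<close>. The number four of its colors
  leaves a spare matching edge that extends any short path to a rainbow one.\<close>

lemma dominant_color_of_matching:
  assumes U: "U \<subseteq> V" "finite U"
    and \<mu>: "\<And>u. u \<in> U \<Longrightarrow> \<mu> u \<in> U \<and> \<mu> u \<noteq> u \<and> \<mu> (\<mu> u) = u"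
    and cross: "\<And>u w. u \<in> U \<Longrightarrow> w \<in> U \<Longrightarrow> w \<noteq> u \<Longrightarrow> w \<noteq> \<mu> u \<Longrightarrow> f u w = q"
    and matched: "\<And>u. u \<in> U \<Longrightarrow> f u (\<mu> u) \<noteq> q"
    and four: "card ((\<lambda>u. f u (\<mu> u)) ` U) \<ge> 4"
    and uwv: "distinct [u, w, v]" "{u, w, v} \<subseteq> V"
  shows "f u w = q \<or> f w v = q \<or> f u w = f w v"
proof -
  define g where "g = (\<lambda>u. f u (\<mu> u))"
  have g\<mu>: "g (\<mu> u) = g u" if "u \<in> U" for u
    using \<mu>[OF that] sym by (simp add: g_def)
  have gq: "g u \<noteq> q" if "u \<in> U" for u using matched that by (simp add: g_def)
  have pick: "\<exists>z\<in>U. g z \<notin> {i, j, k}" for i j k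
  proof (rule ccontr)
    assume "\<not> ?thesis"
    then have "g ` U \<subseteq> {i, j, k}" by blast
    then have "card (g ` U) \<le> card {i, j, k}" by (intro card_mono) auto
    also have "\<dots> \<le> 3" by (simp add: card_insert_if)
    finally show False using four by (simp add: g_def)
  qed
  \<comment> \<open>The colors along \<open>v\<close>, \<open>u\<close>, \<open>\<mu> u\<close>,
    \<open>z\<close>, \<open>\<mu> z\<close> are \<open>f v u\<close>, \<open>g u\<close>,
    \<open>q\<close>, \<open>g z\<close>, where \<open>g z\<close> is spare.\<close>
  have A: "f v u = q \<or> f v u = g u" if v: "v \<in> V - U" and u: "u \<in> U" for u v
  proof -
    obtain z where z: "z \<in> U" "g z \<noteq> g u" "g z \<noteq> f v u" using pick[of "g u" "f v u"] by auto
    then have "z \<noteq> u" "z \<noteq> \<mu> u" "\<mu> z \<noteq> u" "\<mu> z \<noteq> \<mu> u" using g\<mu>[OF u] g\<mu>[OF z(1)] by auto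
    then have "repeats v u (\<mu> u) z (\<mu> z)" and "f (\<mu> u) z = q"
      using u v z(1) U(1) \<mu>[OF u] \<mu>[OF z(1)] by (intro P5_repeats cross; auto)+
    then show ?thesis using z gq[OF u] gq[OF z(1)] unfolding g_def by metis
  qed
  \<comment> \<open>Otherwise \<open>A\<close> makes these colors \<open>g u\<close> and
    \<open>g w\<close>, and the path \<open>\<mu> z\<close>, \<open>z\<close>, \<open>u\<close>,
    \<open>v\<close>, \<open>w\<close> is rainbow.\<close>
  have B: "f v u = q \<or> f v w = q" if v: "v \<in> V - U" and uw: "u \<in> U" "w \<in> U" "g u \<noteq> g w" for u v w
  proof -
    obtain z where z: "z \<in> U" "g z \<noteq> g u" "g z \<noteq> g w" using pick[of "g u" "g w"] by auto
    then have ne: "z \<noteq> u" "z \<noteq> \<mu> u" "\<mu> z \<noteq> u" "z \<noteq> w" "\<mu> z \<noteq> w" "u \<noteq> w"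
      using g\<mu>[OF uw(1)] g\<mu>[OF z(1)] uw by auto
    then have "repeats (\<mu> z) z u v w" and zu: "f z u = q"
      using uw v z(1) U(1) \<mu>[OF z(1)] by (intro P5_repeats cross; auto)+
    moreover have "f (\<mu> z) z = g z" using sym by (simp add: g_def)
    moreover have "f u v = f v u" by (rule sym)
    ultimately show ?thesis using A[OF v uw(1)] A[OF v uw(2)] uw z gq[OF z(1)] by metis
  qed
  have mixed: "f u w = q \<or> f w v = q \<or> f u w = f w v"
    if uwv: "distinct [u, w, v]" "{u, w, v} \<subseteq> V" and "w \<notin> U" "u \<in> U" "v \<notin> U" for u w v
  proof -
    obtain z where z: "z \<in> U" "g z \<noteq> g u" "g z \<noteq> f w v" using pick[of "g u" "f w v"] by auto
    then have ne: "z \<noteq> u" "z \<noteq> \<mu> u" "\<mu> z \<noteq> u" "u \<noteq> \<mu> z"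
      using g\<mu>[OF \<open>u \<in> U\<close>] g\<mu>[OF z(1)] by auto
    have "repeats (\<mu> z) z u w v" and zu: "f z u = q"
      using that z(1) U(1) \<mu>[OF z(1)] ne by (intro P5_repeats cross; auto)+
    moreover have "f (\<mu> z) z = g z" using sym by (simp add: g_def)
    moreover have "f u w = q \<or> f u w = g u" using A[of w u] that by (auto simp: sym[of w u])
    ultimately show ?thesis using z gq[OF z(1)] by metis
  qed
  consider "w \<in> U" | "w \<notin> U" "u \<in> U" "v \<in> U" | "w \<notin> U" "u \<in> U" "v \<notin> U"
    | "w \<notin> U" "u \<notin> U" "v \<in> U" | "w \<notin> U" "u \<notin> U" "v \<notin> U" by blast
  then show ?thesis
  proof cases
    case 1
    have "f w x = q \<or> f w x = g w" if "x \<in> V" "x \<noteq> w" for x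
      using A[of x w] cross[of w x] that 1 by (cases "x \<in> U"; cases "x = \<mu> w") (auto simp: g_def sym[of x w])
    from this[of u] this[of v] show ?thesis using uwv by (auto simp: sym[of u w])
  next
    case 2
    then show ?thesis using A[of w u] A[of w v] B[of w u v] uwv by (auto simp: sym[of u w])
  next
    case 3
    then show ?thesis using mixed uwv by blast
  next
    case 4
    then show ?thesis using mixed[of v w u] uwv by (auto simp: sym[of v w] sym[of w u])
  next
    case 5
    \<comment> \<open>Two spare matching edges of different colors are needed: by \<open>B\<close>,
      one of \<open>z0\<close>, \<open>z1\<close> is joined to \<open>v\<close> in color
      \<open>q\<close>, and that one extends \<open>u w v\<close>.\<close>
    obtain z0 where z0: "z0 \<in> U" "g z0 \<notin> {f u w, f w v}" using pick[of "f u w" "f w v"] by auto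
    obtain z1 where z1: "z1 \<in> U" "g z1 \<notin> {f u w, f w v, g z0}"
      using pick[of "f u w" "f w v" "g z0"] by auto
    obtain z where z: "z \<in> U" "g z \<notin> {f u w, f w v}" "f v z = q"
      using z0 z1 B[of v z0 z1] 5 uwv by auto
    have "repeats u w v z (\<mu> z)"
      using uwv 5 z(1) U(1) \<mu>[OF z(1)] by (intro P5_repeats; auto)
    then show ?thesis using z gq[OF z(1)] unfolding g_def by auto
  qed
qed

lemma finite_colors: "finite V \<Longrightarrow> finite colors"
  by (rule finite_subset[of _ "(\<lambda>(x, y). f x y) ` (V \<times> V)"]) (auto simp: colors_def)

text \<open>For each color \<open>j\<close> other than \<open>q\<close> take an end
  \<open>X j\<close> of an edge of that color. By dominance \<open>X j\<close> meets only the colors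
  \<open>j\<close> and \<open>q\<close>, so these vertices are distinct and pairwise joined in color
  \<open>q\<close>. The bound loses one because \<open>q\<close> itself gives no vertex.\<close>

lemma clique_of_dominant_color:
  assumes "finite V"
    and dom: "\<And>u w v. distinct [u, w, v] \<Longrightarrow> {u, w, v} \<subseteq> V \<Longrightarrow>
      f u w = q \<or> f w v = q \<or> f u w = f w v"
  shows "\<exists>K\<subseteq>V. card K \<ge> card colors - 1 \<and> (\<forall>x\<in>K. \<forall>y\<in>K. x \<noteq> y \<longrightarrow> f x y = q)"
proof -
  have "\<forall>j\<in>colors. \<exists>x y. x \<in> V \<and> y \<in> V \<and> x \<noteq> y \<and> f x y = j"
    by (auto simp: colors_def)
  then obtain X Y where XY: "\<And>j. j \<in> colors \<Longrightarrow> X j \<in> V \<and> Y j \<in> V \<and> X j \<noteq> Y j \<and> f (X j) (Y j) = j"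
    by metis
  have *: "f (X i) w = q \<or> f (X i) w = i" if "i \<in> colors - {q}" "w \<in> V" "w \<noteq> X i" for i w
  proof (cases "w = Y i")
    case False
    then show ?thesis
      using dom[of "Y i" "X i" w] XY[of i] that by (auto simp: sym[of "Y i" "X i"])
  qed (use XY that in auto)
  have inj: "inj_on X (colors - {q})"
  proof (rule inj_onI)
    fix i j assume ij: "i \<in> colors - {q}" "j \<in> colors - {q}" "X i = X j"
    show "i = j" using *[OF ij(1), of "Y j"] XY[of j] ij by auto
  qed
  let ?K = "X ` (colors - {q})"
  have "card ?K = card (colors - {q})" using inj by (rule card_image)
  then have "card ?K \<ge> card colors - 1"
    using finite_colors[OF assms(1)] by (simp add: card_Diff_singleton_if)
  moreover have "f x y = q" if xy: "x \<in> ?K" "y \<in> ?K" "x \<noteq> y" for x y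
  proof -
    obtain i j where ij: "i \<in> colors - {q}" "j \<in> colors - {q}" "x = X i" "y = X j" using xy by blast
    then have "i \<noteq> j" using xy by blast
    then show ?thesis using *[of i y] *[of j x] ij xy XY[of i] XY[of j] by (auto simp: sym[of "X j" "X i"])
  qed
  moreover have "?K \<subseteq> V" using XY by auto
  ultimately show ?thesis by blast
qed

end

section \<open>Dominance from two fresh edges, and the existence of a fresh edge\<close>

context rainbow_P4
begin

lemma dominant_color_of_two_fresh_edges:
  assumes "distinct [x, y, z, w]" "{x, y, z, w} \<subseteq> outside"
    and "fresh (f x y)" "fresh (f z w)" "f x y \<noteq> f z w"
    and "distinct [u, v, t]" "{u, v, t} \<subseteq> V"
  shows "f u v = f b c \<or> f v t = f b c \<or> f u v = f v t"
proof -
  interpret rev: rainbow_P4 V f d c b a by (rule P4_reverse)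
  note r = rev.two_fresh_edges_inner[unfolded reverse_outside reverse_fresh]
    rev.two_fresh_edges_chords[unfolded reverse_outside reverse_fresh]
  have D: "distinct [a, b, c, d, x, y, z, w]" "{a, b, c, d, x, y, z, w} \<subseteq> V"
    using assms outside_distinct[of x] outside_distinct[of y] outside_distinct[of z]
      outside_distinct[of w] by auto
  note c = two_fresh_edges_cross two_fresh_edges_inner two_fresh_edges_chords r
  \<comment> \<open>The earlier lemmas each speak of representative edges only; exchanging the ends
    of \<open>x y\<close>, the ends of \<open>z w\<close>, or the two edges yields the
    others.\<close>
  have perm: "distinct [y, x, z, w]" "{y, x, z, w} \<subseteq> outside" "fresh (f y x)" "f y x \<noteq> f z w"
    "distinct [x, y, w, z]" "{x, y, w, z} \<subseteq> outside" "fresh (f w z)" "f x y \<noteq> f w z"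
    "distinct [y, x, w, z]" "{y, x, w, z} \<subseteq> outside" "f y x \<noteq> f w z"
    "distinct [z, w, x, y]" "{z, w, x, y} \<subseteq> outside" "f z w \<noteq> f x y"
    "distinct [w, z, x, y]" "{w, z, x, y} \<subseteq> outside" "f w z \<noteq> f x y"
    using assms sym[of y x] sym[of w z] by auto
  note c1 = c[OF assms(1-5)] c[OF perm(1,2,3) assms(4) perm(4)] c[OF perm(5,6) assms(3) perm(7,8)]
    c[OF perm(9,10,3,7,11)] c[OF perm(12,13) assms(4,3) perm(14)] c[OF perm(15,16,7) assms(3) perm(17)]
  have e: "f x z = f b c" "f x w = f b c" "f y z = f b c" "f y w = f b c"
    "f a x = f b c" "f a y = f b c" "f a z = f b c" "f a w = f b c"
    "f b x = f b c" "f b y = f b c" "f b z = f b c" "f b w = f b c"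
    "f c x = f b c" "f c y = f b c" "f c z = f b c" "f c w = f b c"
    "f d x = f b c" "f d y = f b c" "f d z = f b c" "f d w = f b c"
    "f a c = f b c" "f a d = f b c" "f b d = f b c"
    using c1 sym[of c b] sym[of b d] by simp_all
  have "f i j = f b c" if "i \<in> {a, b, c, d}" "j \<in> {x, y, z, w}" for i j
    using that e by blast
  then have cr: "f i j = f b c \<and> f j i = f b c"
    if "i \<in> {a, b, c, d}" "j \<in> {x, y, z, w}" for i j
    using that sym by metis
  have "f i j = f b c" if "i \<in> {x, y}" "j \<in> {z, w}" for i j
    using that e by blast
  then have cr2: "f i j = f b c \<and> f j i = f b c" if "i \<in> {x, y}" "j \<in> {z, w}" for i j
    using that sym by metis
  have ch: "f a c = f b c" "f c a = f b c" "f a d = f b c" "f d a = f b c" "f b d = f b c"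
    "f d b = f b c" "f c b = f b c"
    using e sym by metis+
  \<comment> \<open>The matching consists of \<open>a b\<close>, \<open>c d\<close>,
    \<open>x y\<close> and \<open>z w\<close>, whose four colors just reach the number
    required.\<close>
  define \<mu> where "\<mu> = (\<lambda>v. v)(a := b, b := a, c := d, d := c, x := y, y := x, z := w, w := z)"
  have \<mu>: "\<mu> a = b" "\<mu> b = a" "\<mu> c = d" "\<mu> d = c" "\<mu> x = y" "\<mu> y = x" "\<mu> z = w" "\<mu> w = z"
    using D by (auto simp: \<mu>_def)
  define U where "U = {a, b, c, d, x, y, z, w}"
  have g: "(\<lambda>u. f u (\<mu> u)) ` U = {f a b, f c d, f x y, f z w}"
    using \<mu> by (auto simp: U_def sym[of b a] sym[of d c] sym[of y x] sym[of w z])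
  show ?thesis
  proof (rule dominant_color_of_matching[of U \<mu>])
    show "U \<subseteq> V" "finite U" using D by (auto simp: U_def)
    show "\<mu> u \<in> U \<and> \<mu> u \<noteq> u \<and> \<mu> (\<mu> u) = u" if "u \<in> U" for u
      using that \<mu> D(1) by (auto simp: U_def)
    show "f u v = f b c" if "u \<in> U" "v \<in> U" "v \<noteq> u" "v \<noteq> \<mu> u" for u v
    proof -
      note uv = that
      consider "u \<in> {a, b, c, d}" "v \<in> {x, y, z, w}" | "v \<in> {a, b, c, d}" "u \<in> {x, y, z, w}"
        | "u \<in> {a, b, c, d}" "v \<in> {a, b, c, d}" | "u \<in> {x, y}" "v \<in> {z, w}"
        | "v \<in> {x, y}" "u \<in> {z, w}" | "u \<in> {x, y}" "v \<in> {x, y}" | "u \<in> {z, w}" "v \<in> {z, w}"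
        using uv(1,2) unfolding U_def by blast
      then show ?thesis
      proof cases
        case 3 then show ?thesis using that(3,4) \<mu>(1-4) ch by (elim insertE) auto
      qed (use cr cr2 that(3,4) \<mu> in auto)
    qed
    show "f u (\<mu> u) \<noteq> f b c" if "u \<in> U" for u
    proof -
      have "f u (\<mu> u) \<in> {f a b, f c d, f x y, f z w}" using that g by blast
      then show ?thesis using assms(3,4) P4_rainbow by (auto simp: fresh_def)
    qed
    have "card {f a b, f c d, f x y, f z w} = 4"
      using assms(3-5) P4_rainbow by (auto simp: fresh_def)
    then show "card ((\<lambda>u. f u (\<mu> u)) ` U) \<ge> 4" using g by simp
  qed (use assms in auto)
qed

text \<open>The path \<open>x d c b a\<close> keeps fresh colors off \<open>d x\<close>. If the two
  colors differed, \<open>d x b c y\<close> would force \<open>f d x = f b c\<close>, which makes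
  \<open>a b x d c\<close> rainbow.\<close>

lemma fresh_inner_edges:
  assumes "x \<in> outside" "y \<in> outside" "x \<noteq> y" "fresh (f b x)" "fresh (f c y)"
  shows "f b x = f c y"
proof -
  have D: "distinct [a, b, c, d, x, y]" "{a, b, c, d, x, y} \<subseteq> V"
    using assms outside_distinct[of x] outside_distinct[of y] by auto
  have "repeats x d c b a" "repeats d x b c y" "repeats a b x d c"
    by - (rule P5_repeats; use D in auto)+
  then show ?thesis
    using assms(4,5) P4_rainbow
    unfolding fresh_def by (smt (verit) sym distinct_length_2_or_more insert_iff empty_iff)
qed

definition branch_b :: "'b set" where
  "branch_b = {s \<in> f b ` outside. fresh s}"

definition branch_c :: "'b set" where
  "branch_c = {s \<in> f c ` outside. fresh s}"

lemma reverse_branch: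
  "rainbow_P4.branch_b V f d c b a = branch_c" "rainbow_P4.branch_c V f d c b a = branch_b"
  using rainbow_P4.branch_b_def[OF P4_reverse] rainbow_P4.branch_c_def[OF P4_reverse]
  by (auto simp: branch_b_def branch_c_def reverse_outside reverse_fresh)

text \<open>The ends of the path send no fresh color outside, so a fresh color sits on a chord or on
  an edge from \<open>b\<close> or \<open>c\<close> to the outside.\<close>

lemma colors_subset:
  assumes none: "\<And>x y. x \<in> outside \<Longrightarrow> y \<in> outside \<Longrightarrow> x \<noteq> y \<Longrightarrow> \<not> fresh (f x y)"
  shows "colors \<subseteq> {f a b, f b c, f c d, f a c, f b d, f a d} \<union> branch_b \<union> branch_c"
proof
  interpret rev: rainbow_P4 V f d c b a by (rule P4_reverse)
  fix s assume "s \<in> colors"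
  then obtain u v where uv: "s = f u v" "u \<in> V" "v \<in> V" "u \<noteq> v" by (auto simp: colors_def)
  show "s \<in> {f a b, f b c, f c d, f a c, f b d, f a d} \<union> branch_b \<union> branch_c"
  proof (cases "fresh s")
    case True
    have *: "s \<in> {f a c, f b d, f a d} \<union> branch_b \<union> branch_c"
      if "s = f u v" "u \<in> {a, b, c, d}" "v \<in> V" "u \<noteq> v" for u v
    proof (cases "v \<in> outside")
      case True
      then show ?thesis
        using that \<open>fresh s\<close> end_to_outside[of v]
          rev.end_to_outside[of v, unfolded reverse_outside reverse_fresh]
        by (auto simp: branch_b_def branch_c_def)
    next
      case False
      then have "v \<in> {a, b, c, d}" using that by (auto simp: outside_def)
      then show ?thesis using that \<open>fresh s\<close>
        by (auto simp: fresh_def sym[of b a] sym[of c b] sym[of d c] sym[of c a] sym[of d b] sym[of d a])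
    qed
    have "u \<in> {a, b, c, d} \<or> v \<in> {a, b, c, d}"
      using none[of u v] uv True by (auto simp: outside_def)
    then show ?thesis using *[of u v] *[of v u] uv sym[of v u] by auto
  qed (auto simp: fresh_def)
qed

text \<open>If \<open>b\<close> has two fresh colors outside, these already include all fresh colors that \<open>c\<close> has
  there, so the color degree bound at \<open>b\<close> leaves at most eight colors in total.\<close>

lemma branch_b_small:
  assumes "finite V" "card colors \<ge> 9" "card (f b ` (V - {b})) \<le> 5"
    and none: "\<And>x y. x \<in> outside \<Longrightarrow> y \<in> outside \<Longrightarrow> x \<noteq> y \<Longrightarrow> \<not> fresh (f x y)"
  shows "card branch_b \<le> 1"
proof (rule ccontr)
  assume two: "\<not> card branch_b \<le> 1"
  have "branch_c \<subseteq> branch_b"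
  proof
    fix t assume t: "t \<in> branch_c"
    then obtain y where y: "y \<in> outside" "t = f c y" "fresh t" by (auto simp: branch_c_def)
    show "t \<in> branch_b"
    proof (rule ccontr)
      assume nt: "t \<notin> branch_b"
      \<comment> \<open>For \<open>x\<close> other than \<open>y\<close>,
        \<open>fresh_inner_edges\<close> would give \<open>s = t\<close> and put \<open>t\<close>
        into \<open>branch_b\<close>.\<close>
      have "s = f b y" if s: "s \<in> branch_b" for s
      proof -
        obtain x where "x \<in> outside" "s = f b x" "fresh s"
          using s by (auto simp: branch_b_def)
        then show ?thesis using fresh_inner_edges[of x y] y nt s by (cases "x = y") auto
      qed
      then have "branch_b \<subseteq> {f b y}" by blast
      then have "card branch_b \<le> 1" using card_mono[of "{f b y}" branch_b] by auto
      with two show False ..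
    qed
  qed
  moreover have "branch_b \<subseteq> f b ` (V - {b})"
    by (auto simp: branch_b_def outside_def)
  moreover have "{f a b, f b c, f b d} \<subseteq> f b ` (V - {b})"
    using P4_distinct P4_sub sym[of a b] by auto
  ultimately have "colors \<subseteq> f b ` (V - {b}) \<union> {f c d, f a c, f a d}"
    using colors_subset[OF none] by auto
  then have "card colors \<le> card (f b ` (V - {b}) \<union> {f c d, f a c, f a d})"
    using assms(1) by (intro card_mono) auto
  also have "\<dots> \<le> card (f b ` (V - {b})) + card {f c d, f a c, f a d}"
    by (rule card_Un_le)
  also have "\<dots> \<le> 5 + 3"
    using assms(3) by (intro add_mono) (simp_all add: card_insert_if)
  finally show False using assms(2) by simp
qed

lemma exists_fresh_edge_outside:
  assumes "finite V" "card colors \<ge> 9"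
    and deg: "\<And>v. v \<in> V \<Longrightarrow> card (f v ` (V - {v})) \<le> 5"
  shows "\<exists>x y. x \<in> outside \<and> y \<in> outside \<and> x \<noteq> y \<and> fresh (f x y)"
proof (rule ccontr)
  assume "\<not> ?thesis"
  then have none: "\<And>x y. x \<in> outside \<Longrightarrow> y \<in> outside \<Longrightarrow> x \<noteq> y \<Longrightarrow> \<not> fresh (f x y)"
    by blast
  interpret rev: rainbow_P4 V f d c b a by (rule P4_reverse)
  have b: "card branch_b \<le> 1"
    using branch_b_small[OF assms(1,2) deg none] P4_sub by auto
  have c: "card branch_c \<le> 1"
    using rev.branch_b_small[OF assms(1,2) deg, unfolded reverse_outside reverse_fresh reverse_branch]
      none P4_sub by auto
  have "finite outside" using assms(1) by (simp add: outside_def)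
  then have fin: "finite branch_b" "finite branch_c" by (simp_all add: branch_b_def branch_c_def)
  \<comment> \<open>Six edges among the path vertices and one more color for each inner vertex make
    at most eight colors.\<close>
  have "card colors \<le> card ({f a b, f b c, f c d, f a c, f b d, f a d} \<union> branch_b \<union> branch_c)"
    using colors_subset[OF none] fin by (intro card_mono) auto
  also have "\<dots> \<le> card {f a b, f b c, f c d, f a c, f b d, f a d} + card branch_b + card branch_c"
    by (intro order.trans[OF card_Un_le] add_mono card_Un_le) auto
  also have "\<dots> \<le> 6 + 1 + 1"
    using b c by (intro add_mono) (simp_all add: card_insert_if)
  finally show False using assms(2) by simp
qed

end

context rainbow_P5_free
begin

lemma large_monochromatic_clique:
  assumes "finite V" "card colors \<ge> 9"
  shows "\<exists>K\<subseteq>V. \<exists>q. card K \<ge> card colors - 1 \<and> (\<forall>x\<in>K. \<forall>y\<in>K. x \<noteq> y \<longrightarrow> f x y = q)"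
proof (cases "\<exists>a\<in>V. card (f a ` (V - {a})) \<ge> 6")
  case True
  then obtain a where a: "a \<in> V" "card (f a ` (V - {a})) \<ge> 6" by blast
  then obtain q where q: "\<forall>x\<in>V - {a}. \<forall>y\<in>V - {a}. x \<noteq> y \<longrightarrow> f x y = q"
    using hub by blast
  have "s \<in> insert q (f a ` (V - {a}))" if s: "s \<in> colors" for s
  proof -
    obtain x y where "s = f x y" "x \<in> V" "y \<in> V" "x \<noteq> y" using s unfolding colors_def by blast
    then show ?thesis using q by (cases "x = a"; cases "y = a") (auto simp: sym[of x a])
  qed
  \<comment> \<open>Beyond the colors at \<open>a\<close>, at most one for each other vertex, there
    is only \<open>q\<close>.\<close>
  then have "card colors \<le> card (insert q (f a ` (V - {a})))"
    using assms(1) by (intro card_mono) auto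
  also have "\<dots> \<le> Suc (card (V - {a}))"
    using assms(1) card_image_le[of "V - {a}" "f a"] by (simp add: card_insert_if)
  finally have "card (V - {a}) \<ge> card colors - 1" by simp
  then show ?thesis using q by (intro exI[of _ "V - {a}"]) auto
next
  case False
  then have deg: "card (f v ` (V - {v})) \<le> 5" if "v \<in> V" for v using that by force
  have "card colors \<ge> 4" using assms(2) by simp
  then obtain a b c d where "distinct [a, b, c, d]" "{a, b, c, d} \<subseteq> V" "distinct [f a b, f b c, f c d]"
    by (rule exists_rainbow_P4)
  then interpret P: rainbow_P4 V f a b c d by unfold_locales
  obtain x y where xy: "x \<in> P.outside" "y \<in> P.outside" "x \<noteq> y" "P.fresh (f x y)"
    using P.exists_fresh_edge_outside[OF assms deg] by blast
  \<comment> \<open>A color off these four is fresh and differs from \<open>f x y\<close>, so its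
    edge \<open>z w\<close> avoids the path; \<open>adjacent_fresh_edges\<close> makes it disjoint
    from \<open>x y\<close>.\<close>
  define F where "F = {f a b, f b c, f c d, f x y}"
  have "card F \<le> 4" by (simp add: F_def card_insert_if)
  then have "\<not> colors \<subseteq> F"
    using assms(2) card_mono[of F colors] by (auto simp: F_def)
  then obtain z w where zw: "z \<in> V" "w \<in> V" "z \<noteq> w" "P.fresh (f z w)" "f z w \<noteq> f x y"
    by (auto simp: colors_def F_def P.fresh_def)
  then have out: "z \<in> P.outside" "w \<in> P.outside"
    using P.fresh_edges_outside[OF xy, of z w] P.fresh_edges_outside[OF xy, of w z] sym[of w z] by auto
  have apart: "z' \<noteq> x'"
    if "x' \<in> P.outside" "y' \<in> P.outside" "x' \<noteq> y'" "P.fresh (f x' y')"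
      "w' \<in> P.outside" "z' \<noteq> w'" "P.fresh (f z' w')" "f z' w' \<noteq> f x' y'" for x' y' z' w'
    using P.adjacent_fresh_edges[of x' y' w'] that by metis
  have flip: "f y x = f x y" "f w z = f z w" by (rule sym)+
  have "z \<noteq> x" "z \<noteq> y" "w \<noteq> x" "w \<noteq> y"
    using apart[of x y w z] apart[of y x w z] apart[of x y z w] apart[of y x z w] xy out zw
    unfolding flip by simp_all
  then have "distinct [x, y, z, w]" "{x, y, z, w} \<subseteq> P.outside" using xy out zw by auto
  note dominant = P.dominant_color_of_two_fresh_edges[OF this xy(4) zw(4) zw(5)[symmetric]]
  show ?thesis using clique_of_dominant_color[OF assms(1) dominant] by blast
qed

end

section \<open>Counting paths on five vertices\<close>

lemma card_2_to_1:
  assumes "finite L" "\<And>l. l \<in> L \<Longrightarrow> card {l' \<in> L. h l' = h l} = 2"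
  shows "card L = 2 * card (h ` L)"
proof -
  have "card L = (\<Sum>y\<in>h ` L. card {l \<in> L. h l = y})"
    using sum.image_gen[OF assms(1), of "\<lambda>_. 1::nat" h] by simp
  also have "\<dots> = (\<Sum>y\<in>h ` L. 2)" using assms(2) by (intro sum.cong) auto
  finally show ?thesis by simp
qed

text \<open>A path on five vertices is counted through its vertex sequences: there are exactly two,
  exchanged by reversal.\<close>

definition path_of :: "'a list \<Rightarrow> 'a graph" where
  "path_of l = (set l, {{l ! i, l ! Suc i} | i. Suc i < length l})"

definition lists5 :: "'a set \<Rightarrow> 'a list set" where
  "lists5 V = {l. length l = 5 \<and> distinct l \<and> set l \<subseteq> V}"

lemma length_5E:
  assumes "length l = 5"
  obtains a b c d e where "l = [a, b, c, d, e]"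
  using assms by (auto simp: length_Suc_conv eval_nat_numeral)

lemma path_of_5:
  "path_of [a, b, c, d, e] = ({a, b, c, d, e}, {{a, b}, {b, c}, {c, d}, {d, e}})"
proof -
  have len: "Suc i < length [a, b, c, d, e] \<longleftrightarrow> i = 0 \<or> i = 1 \<or> i = 2 \<or> i = 3" for i
    by auto
  have "{{[a, b, c, d, e] ! i, [a, b, c, d, e] ! Suc i} | i. Suc i < length [a, b, c, d, e]} =
    (\<lambda>i. {[a, b, c, d, e] ! i, [a, b, c, d, e] ! Suc i}) ` {0, 1, 2, 3}"
    unfolding len by blast
  also have "\<dots> = {{a, b}, {b, c}, {c, d}, {d, e}}" by simp
  finally show ?thesis unfolding path_of_def by simp
qed

lemma path_of_5_eq_iff:
  assumes "distinct [a, b, c, d, e]" "distinct [a', b', c', d', e']"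
  shows "path_of [a, b, c, d, e] = path_of [a', b', c', d', e'] \<longleftrightarrow>
    [a', b', c', d', e'] = [a, b, c, d, e] \<or> [a', b', c', d', e'] = [e, d, c, b, a]"
proof
  assume "path_of [a, b, c, d, e] = path_of [a', b', c', d', e']"
  then have E: "{a', b'} \<in> {{a, b}, {b, c}, {c, d}, {d, e}}" "{b', c'} \<in> {{a, b}, {b, c}, {c, d}, {d, e}}"
    "{c', d'} \<in> {{a, b}, {b, c}, {c, d}, {d, e}}" "{d', e'} \<in> {{a, b}, {b, c}, {c, d}, {d, e}}"
    by (auto simp: path_of_5)
  have step: "u = a \<and> v = b \<or> u = b \<and> v = a \<or> u = b \<and> v = c \<or> u = c \<and> v = b
    \<or> u = c \<and> v = d \<or> u = d \<and> v = c \<or> u = d \<and> v = e \<or> u = e \<and> v = d"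
    if "{u, v} \<in> {{a, b}, {b, c}, {c, d}, {d, e}}" for u v
    using that by (auto simp: doubleton_eq_iff)
  show "[a', b', c', d', e'] = [a, b, c, d, e] \<or> [a', b', c', d', e'] = [e, d, c, b, a]"
  proof -
    \<comment> \<open>The prefix grows vertex by vertex: three consecutive vertices fit into the
      path in six ways, four in four ways, all five in two.\<close>
    have "a' = a \<and> b' = b \<and> c' = c \<or> a' = b \<and> b' = c \<and> c' = d \<or> a' = c \<and> b' = d \<and> c' = e
      \<or> a' = c \<and> b' = b \<and> c' = a \<or> a' = d \<and> b' = c \<and> c' = b \<or> a' = e \<and> b' = d \<and> c' = c"
      using step[OF E(1)] step[OF E(2)] assms by (elim disjE) simp_all
    then have "a' = a \<and> b' = b \<and> c' = c \<and> d' = d \<or> a' = b \<and> b' = c \<and> c' = d \<and> d' = e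
      \<or> a' = d \<and> b' = c \<and> c' = b \<and> d' = a \<or> a' = e \<and> b' = d \<and> c' = c \<and> d' = b"
      using step[OF E(3)] assms by (elim disjE) simp_all
    then show ?thesis using step[OF E(4)] assms by (elim disjE) simp_all
  qed
next
  assume "[a', b', c', d', e'] = [a, b, c, d, e] \<or> [a', b', c', d', e'] = [e, d, c, b, a]"
  then show "path_of [a, b, c, d, e] = path_of [a', b', c', d', e']"
    by (auto simp: path_of_5 insert_commute)
qed

lemma path_of_two_to_one:
  assumes "l \<in> lists5 V"
  shows "{l' \<in> lists5 V. path_of l' = path_of l} = {l, rev l}" "l \<noteq> rev l"
proof -
  obtain a b c d e where l: "l = [a, b, c, d, e]"
    using assms length_5E[of l] unfolding lists5_def by blast
  then have D: "distinct [a, b, c, d, e]" using assms by (auto simp: lists5_def)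
  show "l \<noteq> rev l" using D l by auto
  show "{l' \<in> lists5 V. path_of l' = path_of l} = {l, rev l}"
  proof (intro equalityI subsetI)
    fix l' assume l': "l' \<in> {l' \<in> lists5 V. path_of l' = path_of l}"
    then obtain a' b' c' d' e' where l'': "l' = [a', b', c', d', e']"
      using length_5E[of l'] unfolding lists5_def by blast
    then have D': "distinct [a', b', c', d', e']" using l' by (auto simp: lists5_def)
    then show "l' \<in> {l, rev l}"
      using path_of_5_eq_iff[OF D D'] l' unfolding l l'' by auto
  next
    fix l' assume "l' \<in> {l, rev l}"
    then show "l' \<in> {l' \<in> lists5 V. path_of l' = path_of l}"
      using assms path_of_5_eq_iff[of a b c d e e d c b a] D by (auto simp: lists5_def l)
  qed
qed

lemma copies_path_5: "copies (path_graph 5) (complete_graph n) = path_of ` lists5 {..<n}"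
proof (intro equalityI subsetI)
  have E5: "edges (path_graph 5) = {{0, 1}, {1, 2}, {2, 3}, {3, 4}}"
  proof -
    have "Suc i < 5 \<longleftrightarrow> i = 0 \<or> i = 1 \<or> i = 2 \<or> i = 3" for i by presburger
    then have "edges (path_graph 5) = (\<lambda>i. {i, Suc i}) ` {0, 1, 2, 3}"
      unfolding path_graph_def snd_conv by blast
    then show ?thesis by (simp add: numeral_eq_Suc)
  qed
  have V5: "verts (path_graph 5) = {0, 1, 2, 3, 4}"
    by (auto simp: path_graph_def)
  {
    fix S assume "S \<in> copies (path_graph 5) (complete_graph n)"
    then obtain f where f: "bij_betw f (verts (path_graph 5)) (verts S)"
      "edges S = (\<lambda>e. f ` e) ` edges (path_graph 5)" "verts S \<subseteq> {..<n}"
      by (auto simp: copies_def isomorphic_def subgraph_def complete_graph_def)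
    let ?l = "[f 0, f 1, f 2, f 3, f 4]"
    have "S = path_of ?l"
      using f(1,2) by (auto simp: prod_eq_iff path_of_5 E5 V5 bij_betw_def)
    moreover have "distinct ?l"
      using f(1) by (auto simp: V5 bij_betw_def inj_on_def)
    moreover have "set ?l \<subseteq> {..<n}"
      using f(1,3) by (auto simp: V5 bij_betw_def)
    ultimately show "S \<in> path_of ` lists5 {..<n}" by (auto simp: lists5_def)
  next
    fix S assume "S \<in> path_of ` lists5 {..<n}"
    then obtain l where l: "l \<in> lists5 {..<n}" "S = path_of l" by blast
    then obtain a b c d e where l': "l = [a, b, c, d, e]"
      using length_5E[of l] unfolding lists5_def by blast
    have D: "distinct [a, b, c, d, e]" "{a, b, c, d, e} \<subseteq> {..<n}"
      using l l' by (auto simp: lists5_def)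
    let ?f = "\<lambda>i. [a, b, c, d, e] ! i"
    have "bij_betw ?f (verts (path_graph 5)) (verts S)"
      using D by (auto simp: V5 l l' path_of_5 bij_betw_def)
    moreover have "edges S = (\<lambda>e. ?f ` e) ` edges (path_graph 5)"
      by (simp add: E5 l l' path_of_5)
    moreover have "subgraph S (complete_graph n)"
      using D by (auto simp: subgraph_def simple_graph_def complete_graph_def l l' path_of_5)
    ultimately show "S \<in> copies (path_graph 5) (complete_graph n)"
      by (auto simp: copies_def isomorphic_def)
  }
qed

lemma card_paths:
  assumes "finite V" "L \<subseteq> lists5 V" "\<And>l. l \<in> L \<Longrightarrow> rev l \<in> L"
  shows "card L = 2 * card (path_of ` L)"
proof (rule card_2_to_1)
  have "finite (lists5 V)"
    by (rule finite_subset[OF _ finite_lists_length_eq[OF assms(1), of 5]]) (auto simp: lists5_def)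
  then show "finite L" using assms(2) finite_subset by blast
  fix l assume l: "l \<in> L"
  then have "{l' \<in> L. path_of l' = path_of l} = {l, rev l}"
    using path_of_two_to_one(1)[of l V] assms by blast
  then show "card {l' \<in> L. path_of l' = path_of l} = 2"
    using path_of_two_to_one(2)[of l V] assms(2) l by auto
qed

lemma card_lists5:
  assumes "finite V"
  shows "card (lists5 V) = 120 * (card V choose 5)"
proof (cases "card V \<ge> 5")
  case True
  have "card (lists5 V) = \<Prod>{card V - 5 + 1..card V}"
    using card_lists_distinct_length_eq[OF assms True] by (simp add: lists5_def)
  also have "\<dots> = fact (card V) div fact (card V - 5)"
    using fact_div_fact[of "card V - 5" "card V"] by simp
  also have "fact (card V) = fact 5 * fact (card V - 5) * (card V choose 5)"
    using binomial_fact_lemma[OF True] by simp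
  also have "\<dots> div fact (card V - 5) = fact 5 * (card V choose 5)"
    by (simp add: mult.commute mult.left_commute)
  finally show ?thesis by (simp add: fact_numeral)
next
  case False
  have "lists5 V = {}"
  proof (rule ccontr)
    assume "lists5 V \<noteq> {}"
    then obtain l where "length l = 5" "distinct l" "set l \<subseteq> V" by (auto simp: lists5_def)
    then show False using False card_mono[OF assms, of "set l"] distinct_card[of l] by simp
  qed
  then show ?thesis using False by (simp add: binomial_eq_0)
qed

lemma finite_lists5: "finite V \<Longrightarrow> finite (lists5 V)"
  by (rule finite_subset[OF _ finite_lists_length_eq[of V 5]]) (auto simp: lists5_def)

lemma path_of_rev_5: "length l = 5 \<Longrightarrow> path_of (rev l) = path_of l"
  by (erule length_5E) (auto simp: path_of_5 insert_commute)

section \<open>Paths through prescribed edges\<close>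

lemma card_paths_through:
  assumes "finite V"
  shows "card {l \<in> lists5 V. F \<subseteq> edges (path_of l)} =
    2 * card {S \<in> path_of ` lists5 V. F \<subseteq> edges S}"
proof -
  have "{S \<in> path_of ` lists5 V. F \<subseteq> edges S} = path_of ` {l \<in> lists5 V. F \<subseteq> edges (path_of l)}"
    by auto
  moreover have "rev l \<in> {l \<in> lists5 V. F \<subseteq> edges (path_of l)}"
    if "l \<in> {l \<in> lists5 V. F \<subseteq> edges (path_of l)}" for l
    using that by (auto simp: lists5_def path_of_rev_5)
  ultimately show ?thesis
    using card_paths[OF assms, of "{l \<in> lists5 V. F \<subseteq> edges (path_of l)}"] by auto
qed

lemma card_P5_copies:
  assumes "finite V"
  shows "card (path_of ` lists5 V) = 60 * (card V choose 5)"
  using card_paths_through[OF assms, of "{}"] card_lists5[OF assms] by simp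

lemma in_lists5: "[p, q, r, s, t] \<in> lists5 V \<longleftrightarrow> distinct [p, q, r, s, t] \<and> {p, q, r, s, t} \<subseteq> V"
  by (simp add: lists5_def)

text \<open>On such a path \<open>u\<close>, \<open>v\<close>, \<open>w\<close> are consecutive, in
  either direction, from the first, second or third place. Each ordered pair of further vertices
  thus gives six lists, and halving leaves the factor 3.\<close>

lemma card_paths_through_adjacent:
  assumes V: "finite V" "{u, v, w} \<subseteq> V" "distinct [u, v, w]"
  shows "card {S \<in> path_of ` lists5 V. {{u, v}, {v, w}} \<subseteq> edges S} = 3 * ((card V - 3) * (card V - 4))"
proof -
  define W where "W = V - {u, v, w}"
  define P where "P = (SIGMA x : W. W - {x})"
  define A where "A = (\<lambda>(x, y). set [[u, v, w, x, y], [w, v, u, x, y], [x, u, v, w, y],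
    [x, w, v, u, y], [x, y, u, v, w], [x, y, w, v, u]])"
  have "finite W" using V by (simp add: W_def)
  have "card W = card V - 3" using V by (simp add: W_def card_Diff_subset)
  have "card P = (\<Sum>x\<in>W. card (W - {x}))"
    using \<open>finite W\<close> by (simp add: P_def)
  also have "\<dots> = (\<Sum>x\<in>W. card W - 1)" by (intro sum.cong) auto
  finally have cardP: "card P = (card V - 3) * (card V - 4)"
    using \<open>card W = card V - 3\<close> by simp
  have "{l \<in> lists5 V. {{u, v}, {v, w}} \<subseteq> edges (path_of l)} = (\<Union>p\<in>P. A p)" (is "?L = ?R")
  proof (intro equalityI subsetI)
    fix l assume l: "l \<in> ?L"
    then have "length l = 5" by (simp add: lists5_def)
    then obtain p q r s t where l': "l = [p, q, r, s, t]" by (rule length_5E)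
    have D: "distinct [p, q, r, s, t]" "{p, q, r, s, t} \<subseteq> V"
      and e: "{u, v} \<in> {{p, q}, {q, r}, {r, s}, {s, t}}" "{v, w} \<in> {{p, q}, {q, r}, {r, s}, {s, t}}"
      using l by (auto simp: l' in_lists5 path_of_5)
    have PI: "(x, y) \<in> P" if "x \<in> V" "y \<in> V" "distinct [u, v, w, x, y]" for x y
      using that by (auto simp: P_def W_def)
    have step: "i = p \<and> j = q \<or> i = q \<and> j = p \<or> i = q \<and> j = r \<or> i = r \<and> j = q
      \<or> i = r \<and> j = s \<or> i = s \<and> j = r \<or> i = s \<and> j = t \<or> i = t \<and> j = s"
      if "{i, j} \<in> {{p, q}, {q, r}, {r, s}, {s, t}}" for i j
      using that by (auto simp: doubleton_eq_iff)
    have "u = p \<and> v = q \<and> w = r \<or> u = q \<and> v = r \<and> w = s \<or> u = r \<and> v = s \<and> w = t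
      \<or> w = p \<and> v = q \<and> u = r \<or> w = q \<and> v = r \<and> u = s \<or> w = r \<and> v = s \<and> u = t"
      using step[OF e(1)] step[OF e(2)] D(1) V(3) by (elim disjE) simp_all
    then consider "u = p" "v = q" "w = r" | "u = q" "v = r" "w = s" | "u = r" "v = s" "w = t"
      | "w = p" "v = q" "u = r" | "w = q" "v = r" "u = s" | "w = r" "v = s" "u = t" by blast
    then have "(s, t) \<in> P \<and> l \<in> A (s, t) \<or> (p, t) \<in> P \<and> l \<in> A (p, t) \<or> (p, q) \<in> P \<and> l \<in> A (p, q)"
      using D PI[of s t] PI[of p t] PI[of p q] unfolding l' A_def by cases auto
    then show "l \<in> ?R" by blast
  next
    fix l assume "l \<in> ?R"
    then obtain x y where xy: "(x, y) \<in> P" "l \<in> A (x, y)" by auto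
    then have "{x, y} \<subseteq> V" "distinct [u, v, w, x, y]" using V by (auto simp: P_def W_def)
    then show "l \<in> ?L" using V xy(2) unfolding A_def
      by (auto simp: in_lists5 path_of_5 insert_commute)
  qed
  moreover have "card (\<Union>p\<in>P. A p) = (\<Sum>p\<in>P. card (A p))"
  proof (rule card_UN_disjoint)
    show "finite P" using \<open>finite W\<close> by (simp add: P_def)
    show "\<forall>p\<in>P. finite (A p)" by (auto simp: A_def)
    show "\<forall>p\<in>P. \<forall>p'\<in>P. p \<noteq> p' \<longrightarrow> A p \<inter> A p' = {}"
      by (auto simp: P_def W_def A_def)
  qed
  moreover have "card (A p) = 6" if "p \<in> P" for p
  proof -
    obtain x y where p: "p = (x, y)" by fastforce
    have "distinct [u, v, w, x, y]" using that V by (auto simp: P_def W_def p)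
    then show ?thesis by (auto simp: A_def p card_insert_if)
  qed
  ultimately have "card {l \<in> lists5 V. {{u, v}, {v, w}} \<subseteq> edges (path_of l)} = 6 * card P"
    by simp
  then show ?thesis
    using card_paths_through[OF V(1), of "{{u, v}, {v, w}}"] cardP by simp
qed

text \<open>The fifth vertex stands last, in the middle or first; the order of the two edges and
  their orientations give eight lists for each place. Halving 24 leaves the factor 12.\<close>

lemma card_paths_through_disjoint:
  assumes V: "finite V" "{a, b, c, d} \<subseteq> V" "distinct [a, b, c, d]"
  shows "card {S \<in> path_of ` lists5 V. {{a, b}, {c, d}} \<subseteq> edges S} = 12 * (card V - 4)"
proof -
  \<comment> \<open>Keeping the two edges visible as sets allows replacing them by, say,
    \<open>{p, q}\<close> and \<open>{r, s}\<close> without fixing orientations.\<close>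
  define W where "W = V - ({a, b} \<union> {c, d})"
  define A where "A = (\<lambda>x. set [
    [a, b, c, d, x], [b, a, c, d, x], [a, b, d, c, x], [b, a, d, c, x],
    [c, d, a, b, x], [c, d, b, a, x], [d, c, a, b, x], [d, c, b, a, x],
    [a, b, x, c, d], [b, a, x, c, d], [a, b, x, d, c], [b, a, x, d, c],
    [c, d, x, a, b], [c, d, x, b, a], [d, c, x, a, b], [d, c, x, b, a],
    [x, a, b, c, d], [x, b, a, c, d], [x, a, b, d, c], [x, b, a, d, c],
    [x, c, d, a, b], [x, c, d, b, a], [x, d, c, a, b], [x, d, c, b, a]])"
  have "finite W" using V by (simp add: W_def)
  have "W = V - {a, b, c, d}" by (auto simp: W_def)
  moreover have "card {a, b, c, d} = 4" using V(3) by simp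
  ultimately have cardW: "card W = card V - 4" using V by (simp add: card_Diff_subset)
  have "{l \<in> lists5 V. {{a, b}, {c, d}} \<subseteq> edges (path_of l)} = (\<Union>x\<in>W. A x)" (is "?L = ?R")
  proof (intro equalityI subsetI)
    fix l assume l: "l \<in> ?L"
    then have "length l = 5" by (simp add: lists5_def)
    then obtain p q r s t where l': "l = [p, q, r, s, t]" by (rule length_5E)
    have D: "distinct [p, q, r, s, t]" "{p, q, r, s, t} \<subseteq> V"
      and e: "{a, b} \<in> {{p, q}, {q, r}, {r, s}, {s, t}}" "{c, d} \<in> {{p, q}, {q, r}, {r, s}, {s, t}}"
      using l by (auto simp: l' in_lists5 path_of_5)
    \<comment> \<open>Disjoint edges of the path are the first and third, the first and fourth, or
      the second and fourth; they miss \<open>t\<close>, \<open>r\<close> and \<open>p\<close>,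
      respectively.\<close>
    have "X = {p, q} \<and> Y = {r, s} \<or> X = {p, q} \<and> Y = {s, t} \<or> X = {q, r} \<and> Y = {s, t} \<or>
      Y = {p, q} \<and> X = {r, s} \<or> Y = {p, q} \<and> X = {s, t} \<or> Y = {q, r} \<and> X = {s, t}"
      if "X \<in> {{p, q}, {q, r}, {r, s}, {s, t}}" "Y \<in> {{p, q}, {q, r}, {r, s}, {s, t}}" "X \<inter> Y = {}"
      for X Y
      using that by (elim insertE emptyE) simp_all
    moreover have "{a, b} \<inter> {c, d} = {}" using V(3) by auto
    ultimately have "{a, b} = {p, q} \<and> {c, d} = {r, s} \<or> {a, b} = {p, q} \<and> {c, d} = {s, t} \<or>
      {a, b} = {q, r} \<and> {c, d} = {s, t} \<or> {c, d} = {p, q} \<and> {a, b} = {r, s} \<or>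
      {c, d} = {p, q} \<and> {a, b} = {s, t} \<or> {c, d} = {q, r} \<and> {a, b} = {s, t}"
      using e by metis
    then have "t \<in> W \<and> l \<in> A t \<or> r \<in> W \<and> l \<in> A r \<or> p \<in> W \<and> l \<in> A p"
    proof (elim disjE conjE, goal_cases)
      case 1
      have "t \<in> W" using D unfolding W_def 1 by auto
      moreover have "l \<in> A t"
        using 1 unfolding doubleton_eq_iff l' A_def by (elim conjE disjE) simp_all
      ultimately show ?thesis by blast
    next
      case 2
      have "r \<in> W" using D unfolding W_def 2 by auto
      moreover have "l \<in> A r"
        using 2 unfolding doubleton_eq_iff l' A_def by (elim conjE disjE) simp_all
      ultimately show ?thesis by blast
    next
      case 3
      have "p \<in> W" using D unfolding W_def 3 by auto
      moreover have "l \<in> A p"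
        using 3 unfolding doubleton_eq_iff l' A_def by (elim conjE disjE) simp_all
      ultimately show ?thesis by blast
    next
      case 4
      have "t \<in> W" using D unfolding W_def 4 by auto
      moreover have "l \<in> A t"
        using 4 unfolding doubleton_eq_iff l' A_def by (elim conjE disjE) simp_all
      ultimately show ?thesis by blast
    next
      case 5
      have "r \<in> W" using D unfolding W_def 5 by auto
      moreover have "l \<in> A r"
        using 5 unfolding doubleton_eq_iff l' A_def by (elim conjE disjE) simp_all
      ultimately show ?thesis by blast
    next
      case 6
      have "p \<in> W" using D unfolding W_def 6 by auto
      moreover have "l \<in> A p"
        using 6 unfolding doubleton_eq_iff l' A_def by (elim conjE disjE) simp_all
      ultimately show ?thesis by blast
    qed
    then show "l \<in> ?R" by blast
  next
    fix l assume "l \<in> ?R"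
    then obtain x where x: "x \<in> W" "l \<in> A x" by auto
    then have "x \<in> V" "distinct [a, b, c, d, x]" using V by (auto simp: W_def)
    then show "l \<in> ?L" using V x(2) unfolding A_def list.set insert_iff empty_iff
      by (elim disjE) (auto simp: in_lists5 path_of_5 insert_commute)
  qed
  moreover have "card (\<Union>x\<in>W. A x) = (\<Sum>x\<in>W. card (A x))"
  proof (rule card_UN_disjoint)
    show "finite W" by fact
    show "\<forall>x\<in>W. finite (A x)" by (auto simp: A_def)
    have "set l = {a, b, c, d, x}" if "l \<in> A x" for l x
      using that by (auto simp: A_def)
    then have "x = y" if "x \<in> W" "y \<in> W" "l \<in> A x" "l \<in> A y" for l x y
      using that unfolding W_def by blast
    then show "\<forall>x\<in>W. \<forall>y\<in>W. x \<noteq> y \<longrightarrow> A x \<inter> A y = {}" by blast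
  qed
  moreover have "card (A x) = 24" if "x \<in> W" for x
  proof -
    have "distinct [a, b, c, d, x]" using that V by (auto simp: W_def)
    then show ?thesis by (simp add: A_def card_insert_if eq_commute)
  qed
  ultimately have "card {l \<in> lists5 V. {{a, b}, {c, d}} \<subseteq> edges (path_of l)} = 24 * card W"
    by simp
  then show ?thesis
    using card_paths_through[OF V(1), of "{{a, b}, {c, d}}"] cardW by simp
qed

section \<open>The Gallai-Ramsey number and multiplicity\<close>

lemma edges_complete: "edges (complete_graph n) = {e. e \<subseteq> {..<n} \<and> card e = 2}"
  by (simp add: complete_graph_def)

lemma verts_complete: "verts (complete_graph n) = {..<n}"
  by (simp add: complete_graph_def)

lemma finite_edges_complete: "finite (edges (complete_graph n))"
  by (rule finite_subset[of _ "Pow {..<n}"]) (auto simp: edges_complete)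

lemma card_edges_complete: "card (edges (complete_graph n)) = n choose 2"
  using n_subsets[of "{..<n}" 2] by (simp add: edges_complete)

lemma edge_complete: "x < n \<Longrightarrow> y < n \<Longrightarrow> x \<noteq> y \<Longrightarrow> {x, y} \<in> edges (complete_graph n)"
  by (auto simp: edges_complete)

lemma mono_copy_of_clique:
  assumes H: "simple_graph H" and K: "K \<subseteq> {..<n}" "card (verts H) \<le> card K"
    and mono: "\<And>x y. x \<in> K \<Longrightarrow> y \<in> K \<Longrightarrow> x \<noteq> y \<Longrightarrow> c {x, y} = q"
  shows "mono_copies c H (complete_graph n) \<noteq> {}"
proof -
  have "finite K" using K(1) finite_subset by blast
  then obtain h where h: "h ` verts H \<subseteq> K" "inj_on h (verts H)"
    using card_le_inj[OF _ \<open>finite K\<close> K(2)] H unfolding simple_graph_def by blast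
  define S where "S = (h ` verts H, (\<lambda>e. h ` e) ` edges H)"
  have edge: "\<exists>x\<in>K. \<exists>y\<in>K. x \<noteq> y \<and> e = {x, y}" if e: "e \<in> edges S" for e
  proof -
    obtain e' where e': "e' \<in> edges H" "e = h ` e'" using e by (auto simp: S_def)
    then have sub: "e' \<subseteq> verts H" and "card e' = 2" using H by (auto simp: simple_graph_def)
    then obtain u v where uv: "e' = {u, v}" "u \<noteq> v" by (auto simp: card_2_iff)
    have "h u \<noteq> h v" using uv sub h(2) by (auto simp: inj_on_def)
    moreover have "h u \<in> K" "h v \<in> K" using uv sub h(1) by auto
    ultimately show ?thesis using uv(1) e'(2) by auto
  qed
  have "isomorphic H S"
    unfolding isomorphic_def
    by (rule exI[of _ h]) (use h in \<open>auto simp: S_def bij_betw_def\<close>)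
  moreover have "subgraph S (complete_graph n)"
  proof -
    have "finite (verts S)" "verts S \<subseteq> {..<n}"
      using h(1) K(1) \<open>finite K\<close> by (auto simp: S_def intro: finite_subset)
    moreover have "e \<subseteq> verts S" if "e \<in> edges S" for e
      using that H by (auto simp: S_def simple_graph_def)
    moreover have "card e = 2 \<and> e \<subseteq> {..<n}" if "e \<in> edges S" for e
      using edge[OF that] K(1) by auto
    ultimately show ?thesis
      by (auto simp: subgraph_def simple_graph_def edges_complete verts_complete)
  qed
  moreover have "c e = q" if "e \<in> edges S" for e
    using edge[OF that] mono by auto
  ultimately have "S \<in> mono_copies c H (complete_graph n)"
    by (simp add: mono_copies_def copies_def monochromatic_def)
  then show ?thesis by blast
qed

text \<open>Nine colors are what \<open>large_monochromatic_clique\<close> asks for, and the other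
  bound on \<open>m\<close> lets its clique, of at least \<open>m - 1\<close> vertices, hold
  \<open>H\<close>.\<close>

lemma mono_copy_if_no_rainbow_P5:
  assumes c: "c \<in> edge_colorings m (complete_graph n)" and "m \<ge> 9"
    and H: "simple_graph H" "m \<ge> card (verts H) + 1"
    and no_rainbow: "rainbow_copies c (path_graph 5) (complete_graph n) = {}"
  shows "mono_copies c H (complete_graph n) \<noteq> {}"
proof -
  have no: "\<not> rainbow c (path_of l)" if "l \<in> lists5 {..<n}" for l
    using that no_rainbow unfolding rainbow_copies_def copies_path_5 by blast
  interpret rainbow_P5_free "{..<n}" "\<lambda>x y. c {x, y}"
  proof
    show "c {x, y} = c {y, x}" for x y by (simp add: insert_commute)
    fix v0 v1 v2 v3 v4 :: nat
    assume "distinct [v0, v1, v2, v3, v4]" "{v0, v1, v2, v3, v4} \<subseteq> {..<n}"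
    then have "\<not> rainbow c (path_of [v0, v1, v2, v3, v4])" by (intro no) (simp add: in_lists5)
    then show "\<not> distinct [c {v0, v1}, c {v1, v2}, c {v2, v3}, c {v3, v4}]"
      by (auto simp: rainbow_def path_of_5)
  qed
  have "colors = c ` edges (complete_graph n)"
  proof (intro equalityI subsetI)
    fix s assume "s \<in> colors"
    then show "s \<in> c ` edges (complete_graph n)"
      unfolding colors_def using edge_complete[of _ n] by blast
  next
    fix s assume "s \<in> c ` edges (complete_graph n)"
    then obtain e where e: "s = c e" "e \<subseteq> {..<n}" "card e = 2" by (auto simp: edges_complete)
    then obtain x y where "e = {x, y}" "x \<noteq> y" by (auto simp: card_2_iff)
    then show "s \<in> colors" using e colorsI[of x y] by simp
  qed
  then have "card colors = m" using c by (simp add: edge_colorings_def)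
  then obtain K q where "K \<subseteq> {..<n}" "card K \<ge> m - 1" "\<forall>x\<in>K. \<forall>y\<in>K. x \<noteq> y \<longrightarrow> c {x, y} = q"
    using large_monochromatic_clique assms(2) by auto
  then show ?thesis
    using mono_copy_of_clique[OF H(1), of K n c q] H(2) by auto
qed

lemma choose_two_pred: "t \<ge> 1 \<Longrightarrow> ((t - 1) choose 2) + (t - 1) = t choose 2"
  by (cases t) (simp_all add: numeral_2_eq_2)

text \<open>The copies exist for every number of vertices, so only the requirement of
  \<open>k - 1\<close> edges decides the value.\<close>

lemma gallai_ramsey_P5:
  assumes H: "simple_graph H" and k: "k = t choose 2" "k \<ge> card (verts H) + 2" "k \<ge> 10"
  shows "gallai_ramsey (k - 1) (path_graph 5) H = t"
  unfolding gallai_ramsey_def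
proof (rule Least_equality)
  have "rainbow_copies c (path_graph 5) (complete_graph n) \<noteq> {} \<or> mono_copies c H (complete_graph n) \<noteq> {}"
    if "c \<in> edge_colorings (k - 1) (complete_graph n)" for n c
    using mono_copy_if_no_rainbow_P5[OF that _ H] k by auto
  then show "k - 1 \<le> t choose 2 \<and> (\<forall>n\<ge>t. \<forall>c \<in> edge_colorings (k - 1) (complete_graph n).
      rainbow_copies c (path_graph 5) (complete_graph n) \<noteq> {} \<or> mono_copies c H (complete_graph n) \<noteq> {})"
    using k by auto
next
  fix N
  assume "k - 1 \<le> N choose 2 \<and> (\<forall>n\<ge>N. \<forall>c \<in> edge_colorings (k - 1) (complete_graph n).
      rainbow_copies c (path_graph 5) (complete_graph n) \<noteq> {} \<or> mono_copies c H (complete_graph n) \<noteq> {})"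
  then have N: "k - 1 \<le> N choose 2" ..
  show "t \<le> N"
  proof (rule ccontr)
    assume "\<not> t \<le> N"
    then have "N choose 2 \<le> (t - 1) choose 2" by (intro binomial_right_mono) simp
    \<comment> \<open>Below \<open>t\<close> vertices there are at most \<open>k - (t - 1)\<close>
      edges, which is less than \<open>k - 1\<close> once \<open>t\<close> is at least 3.\<close>
    moreover have "t \<ge> 3"
    proof (rule ccontr)
      assume "\<not> t \<ge> 3"
      then have "t choose 2 \<le> 2 choose 2" by (intro binomial_right_mono) simp
      then show False using k by simp
    qed
    ultimately show False using choose_two_pred[of t] N k by linarith
  qed
qed

section \<open>Colorings with a single repetition\<close>

lemma unique_repetition:
  assumes "finite E" "e \<in> E" "f \<in> E" "e \<noteq> f" "c e = c f" "card (c ` E) = card E - 1" "S \<subseteq> E"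
  shows "inj_on c S \<longleftrightarrow> \<not> {e, f} \<subseteq> S"
proof
  assume "inj_on c S"
  then show "\<not> {e, f} \<subseteq> S" using assms(4,5) by (auto simp: inj_on_def)
next
  assume "\<not> {e, f} \<subseteq> S"
  \<comment> \<open>\<open>g\<close> can be whichever of \<open>e\<close>, \<open>f\<close> is
    missing from \<open>S\<close>. Dropping it loses no color, so by counting \<open>c\<close> is
    injective on the rest.\<close>
  then obtain g g' where g: "g \<in> E" "g' \<in> E" "g \<noteq> g'" "c g = c g'" "g \<notin> S"
    using assms(2-5) by (metis empty_subsetI insert_subset)
  have "c ` (E - {g}) = c ` E" using g by (auto simp: image_iff)
  then have "card (c ` (E - {g})) = card (E - {g})" using assms(1,6) g(1) by simp
  then have "inj_on c (E - {g})" using assms(1) by (simp add: eq_card_imp_inj_on)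
  then show "inj_on c S" by (rule inj_on_subset) (use assms(7) g in auto)
qed

text \<open>Without \<open>e\<close>, the edges of a monochromatic copy of \<open>H\<close> would
  have distinct colors, so at most one would be left, while \<open>H\<close> has at least three
  edges. Only rainbow paths remain to be counted.\<close>

lemma card_copies:
  assumes H: "card (edges H) \<ge> 3" "simple_graph H"
    and c: "c \<in> edge_colorings ((t choose 2) - 1) (complete_graph t)"
    and ef: "e \<in> edges (complete_graph t)" "f \<in> edges (complete_graph t)" "e \<noteq> f" "c e = c f"
  shows "card (rainbow_copies c (path_graph 5) (complete_graph t)) + card (mono_copies c H (complete_graph t))
    = 60 * (t choose 5) - card {S \<in> path_of ` lists5 {..<t}. {e, f} \<subseteq> edges S}"
proof -
  let ?K = "complete_graph t"
  have "c ` edges ?K = {1..(t choose 2) - 1}" using c by (simp add: edge_colorings_def)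
  then have "card (c ` edges ?K) = card (edges ?K) - 1"
    by (simp add: card_edges_complete)
  note rep = unique_repetition[OF finite_edges_complete ef this]
  have "mono_copies c H ?K = {}"
  proof (rule ccontr)
    assume "mono_copies c H ?K \<noteq> {}"
    then obtain S where S: "subgraph S ?K" "isomorphic H S" "monochromatic c S"
      by (auto simp: mono_copies_def copies_def)
    then obtain h where h: "bij_betw h (verts H) (verts S)" "edges S = (\<lambda>e. h ` e) ` edges H"
      by (auto simp: isomorphic_def)
    have "inj_on (\<lambda>e. h ` e) (edges H)"
      by (rule inj_on_subset[OF inj_on_image_Pow])
        (use h(1) H(2) in \<open>auto simp: bij_betw_def simple_graph_def\<close>)
    then have three: "card (edges S) \<ge> 3" using H(1) h(2) by (simp add: card_image)
    have "inj_on c (edges S - {e})"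
      using rep[of "edges S - {e}"] S(1) by (auto simp: subgraph_def)
    moreover have "c ` (edges S - {e}) \<subseteq> {c x}" if "x \<in> edges S" for x
      using S(3) that unfolding monochromatic_def by blast
    moreover obtain x where "x \<in> edges S" using three by fastforce
    ultimately have "card (edges S - {e}) \<le> 1"
      using card_inj_on_le[of c "edges S - {e}" "{c x}"] by simp
    then show False using three by (simp add: card_Diff_singleton_if split: if_splits)
  qed
  moreover have "rainbow_copies c (path_graph 5) ?K =
    path_of ` lists5 {..<t} - {S \<in> path_of ` lists5 {..<t}. {e, f} \<subseteq> edges S}"
  proof -
    have "rainbow c S \<longleftrightarrow> \<not> {e, f} \<subseteq> edges S" if "S \<in> copies (path_graph 5) ?K" for S
      using that rep[of "edges S"] by (simp add: copies_def subgraph_def rainbow_def)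
    then show ?thesis unfolding rainbow_copies_def copies_path_5 by blast
  qed
  moreover have "finite (path_of ` lists5 {..<t})" by (simp add: finite_lists5)
  ultimately show ?thesis
    using card_P5_copies[of "{..<t}"] by (simp add: card_Diff_subset)
qed

lemma paths_through_edges:
  assumes "e \<in> edges (complete_graph t)" "f \<in> edges (complete_graph t)" "e \<noteq> f"
  shows "card {S \<in> path_of ` lists5 {..<t}. {e, f} \<subseteq> edges S} \<in>
    {3 * ((t - 3) * (t - 4)), 12 * (t - 4)}"
proof -
  obtain a b c d where e: "e = {a, b}" "a \<noteq> b" and f: "f = {c, d}" "c \<noteq> d"
    using assms by (auto simp: edges_complete card_2_iff)
  have sub: "{a, b, c, d} \<subseteq> {..<t}" using assms e f by (auto simp: edges_complete)
  show ?thesis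
  proof (cases "e \<inter> f = {}")
    case True
    then have "distinct [a, b, c, d]" using e f by auto
    then show ?thesis using card_paths_through_disjoint[of "{..<t}" a b c d] sub e f by simp
  next
    case False
    then obtain v where v: "v \<in> e" "v \<in> f" by blast
    obtain u where u: "e = {u, v}" "u \<noteq> v" using v e by auto
    obtain w where w: "f = {v, w}" "v \<noteq> w" using v f by auto
    have "distinct [u, v, w]" "{u, v, w} \<subseteq> {..<t}" using u w assms by (auto simp: edges_complete)
    then show ?thesis using card_paths_through_adjacent[of "{..<t}" u v w] u w by simp
  qed
qed

lemma exists_coloring_with_repetition:
  assumes "e \<in> edges (complete_graph t)" "f \<in> edges (complete_graph t)" "e \<noteq> f"
  obtains c where "c \<in> edge_colorings ((t choose 2) - 1) (complete_graph t)" "c e = c f"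
proof -
  let ?E = "edges (complete_graph t)"
  have "finite (?E - {e})" using finite_edges_complete by blast
  then obtain g where g: "bij_betw g (?E - {e}) {0..<card (?E - {e})}"
    using ex_bij_betw_finite_nat by blast
  \<comment> \<open>The edges other than \<open>e\<close> are numbered from 1, and \<open>e\<close>
    takes the number of \<open>f\<close>.\<close>
  define c where "c = (\<lambda>x. Suc (g x))(e := Suc (g f))"
  have "c ` ?E = c ` (?E - {e})"
    using assms by (auto simp: c_def image_iff)
  also have "\<dots> = Suc ` g ` (?E - {e})" by (auto simp: c_def)
  also have "\<dots> = {1..(t choose 2) - 1}"
    using g assms(1) by (simp add: bij_betw_def card_edges_complete image_Suc_lessThan lessThan_atLeast0[symmetric])
  finally have "c \<in> edge_colorings ((t choose 2) - 1) (complete_graph t)"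
    by (simp add: edge_colorings_def)
  moreover have "c e = c f" using assms(3) by (simp add: c_def)
  ultimately show ?thesis by (rule that)
qed

theorem theorem3p9:
  fixes H :: "'a graph" and k t :: nat
  assumes "simple_graph H" and "no_isolated_vertices H"
    and "card (edges H) \<ge> 3"
    and "k = t choose 2" and "k \<ge> max (card (verts H) + 2) 10"
  shows "int (gallai_ramsey_mult (k - 1) (path_graph 5) H) =
    (if 5 \<le> t \<and> t \<le> 6 then 60 * int (t choose 5) - 12 * (int t - 4)
     else 60 * int (t choose 5) - 3 * (int t - 3) * (int t - 4))"
proof -
  have t: "t \<ge> 5"
  proof (rule ccontr)
    assume "\<not> t \<ge> 5"
    then have "t choose 2 \<le> 4 choose 2" by (intro binomial_right_mono) simp
    then show False using assms(4,5) by (simp add: numeral_eq_Suc)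
  qed
  define K where "K = complete_graph t"
  define X where "X = (\<lambda>c. card (rainbow_copies c (path_graph 5) K) + card (mono_copies c H K)) `
    edge_colorings (k - 1) K"
  \<comment> \<open>The numbers of paths spoiled by an adjacent and by a disjoint pair of equally
    colored edges; the minimum loses the larger one.\<close>
  define n1 n2 where "n1 = 3 * ((t - 3) * (t - 4))" and "n2 = 12 * (t - 4)"
  define N where "N = (\<lambda>e f. card {S \<in> path_of ` lists5 {..<t}. {e, f} \<subseteq> edges S})"
  have N12: "N e f = n1 \<or> N e f = n2" if "e \<in> edges K" "f \<in> edges K" "e \<noteq> f" for e f
    using paths_through_edges[of e t f] that by (auto simp: N_def K_def n1_def n2_def)
  \<comment> \<open>This bound makes the subtraction of naturals exact when it passes to
    integers.\<close>
  have le: "N e f \<le> 60 * (t choose 5)" for e f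
  proof -
    have "N e f \<le> card (path_of ` lists5 {..<t})"
      unfolding N_def by (intro card_mono) (auto simp: finite_lists5)
    then show ?thesis by (simp add: card_P5_copies)
  qed
  have total: "card (rainbow_copies c (path_graph 5) K) + card (mono_copies c H K) = 60 * (t choose 5) - N e f"
    if "c \<in> edge_colorings (k - 1) K" "e \<in> edges K" "f \<in> edges K" "e \<noteq> f" "c e = c f" for c e f
    using card_copies[OF assms(3,1), of c t e f] that assms(4) by (simp add: K_def N_def)
  have lower: "60 * (t choose 5) - max n1 n2 \<le> x" if x: "x \<in> X" for x
  proof -
    obtain c where c: "c \<in> edge_colorings (k - 1) K"
      "x = card (rainbow_copies c (path_graph 5) K) + card (mono_copies c H K)"
      using x by (auto simp: X_def)
    have "\<not> inj_on c (edges K)"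
    proof
      assume "inj_on c (edges K)"
      then have "card (c ` edges K) = k" using card_edges_complete assms(4) by (simp add: card_image K_def)
      then show False using c(1) assms(5) by (simp add: edge_colorings_def)
    qed
    then obtain e f where ef: "e \<in> edges K" "f \<in> edges K" "e \<noteq> f" "c e = c f"
      by (auto simp: inj_on_def)
    then show ?thesis using total[OF c(1) ef] c(2) N12[OF ef(1-3)] by auto
  qed
  have attained: "60 * (t choose 5) - N e f \<in> X"
    if ef: "e \<in> edges K" "f \<in> edges K" "e \<noteq> f" for e f
  proof -
    obtain c where "c \<in> edge_colorings ((t choose 2) - 1) (complete_graph t)" "c e = c f"
      by (rule exists_coloring_with_repetition[OF ef[unfolded K_def]])
    then have c: "c \<in> edge_colorings (k - 1) K" "c e = c f" by (simp_all add: K_def assms(4))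
    show ?thesis unfolding X_def
      by (rule image_eqI[OF _ c(1)]) (use total[OF c(1) ef c(2)] in simp)
  qed
  \<comment> \<open>The first edge is adjacent to the second and disjoint from the third, so both
    values are attained.\<close>
  have E: "{0, 1} \<in> edges K" "{1, 2} \<in> edges K" "{2, 3} \<in> edges K"
    using t by (auto simp: K_def edges_complete)
  have "N {0, 1} {1, 2} = n1"
    using card_paths_through_adjacent[of "{..<t}" 0 1 2] t by (simp add: N_def n1_def)
  then have 1: "n1 \<le> 60 * (t choose 5)" "60 * (t choose 5) - n1 \<in> X"
    using le[of "{0, 1}" "{1, 2}"] attained[OF E(1,2)] by (auto simp: doubleton_eq_iff)
  have "N {0, 1} {2, 3} = n2"
    using card_paths_through_disjoint[of "{..<t}" 0 1 2 3] t by (simp add: N_def n2_def)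
  then have 2: "n2 \<le> 60 * (t choose 5)" "60 * (t choose 5) - n2 \<in> X"
    using le[of "{0, 1}" "{2, 3}"] attained[OF E(1,3)] by (auto simp: doubleton_eq_iff)
  have "Inf X = 60 * (t choose 5) - max n1 n2"
    by (rule cInf_eq_minimum[OF _ lower]) (use 1 2 in \<open>auto simp: max_def\<close>)
  moreover have "gallai_ramsey_mult (k - 1) (path_graph 5) H = Inf X"
    using gallai_ramsey_P5[OF assms(1,4)] assms(5)
    by (simp add: gallai_ramsey_mult_def X_def K_def Let_def)
  ultimately have main: "int (gallai_ramsey_mult (k - 1) (path_graph 5) H)
      = 60 * int (t choose 5) - int (max n1 n2)"
    using 1(1) 2(1) by (simp add: of_nat_diff)
  have n1: "int n1 = 3 * (int t - 3) * (int t - 4)" and n2: "int n2 = 12 * (int t - 4)"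
    using t by (simp_all add: n1_def n2_def of_nat_diff)
  show ?thesis
  \<comment> \<open>With the common factor \<open>3 * (t - 4)\<close> removed, \<open>t - 3\<close>
    is compared with 4; the two counts agree at \<open>t = 7\<close>.\<close>
  proof (cases "t \<le> 6")
    case True
    then have "n1 \<le> n2" using t by (auto simp: n1_def n2_def)
    then show ?thesis using main n2 True t by simp
  next
    case False
    then have "4 * (t - 4) \<le> (t - 3) * (t - 4)" by (intro mult_right_mono) auto
    then have "n2 \<le> n1" by (simp add: n1_def n2_def)
    then show ?thesis using main n1 False by simp
  qed
qed

end
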